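(* Let $A(z)=v(z)e^{P(z)}$ be an entire function with $\lambda(A)<\rho(A)$, where $P$ is a non-constant polynomial and $v$ is an entire function with $\rho(v)=\lambda(A)$, and let $B(z)$ be an entire function extremal to Yang's inequality such that no Borel direction of $B(z)$ coincides with any of the critical rays of $A(z)$. Then every non-trivial solution $f\not\equiv 0$ of the equation $f''+A(z)f'+B(z)f=0$ satisfies $\rho(f)=\infty$.
   Context: All solutions of the equation are entire functions. For an entire function $f$ with maximum modulus $M(r,f)=\max_{|z|=r}|f(z)|$ and Nevanlinna characteristic $T(r,f)$, the order is $\rho(f)=\limsup_{r\to\infty}\frac{\log^+\log^+M(r,f)}{\log r}=\limsup_{r\to\infty}\frac{\log^+T(r,f)}{\log r}$; $\lambda(f)$ denotes the exponent of convergence of the zeros of $f$. Critical rays: for $P(z)=a_nz^n+\dots+a_0$ with $a_n\neq 0$, put $\delta(P,\theta)=\Re(a_ne^{in\theta})$. A ray $\arg z=\theta$ is a critical ray of $e^{P}$ if $\delta(P,\theta)=0$; the critical rays of $A=ve^{P}$ are those of $e^{P}$. Borel directions: for a meromorphic function $f$ in the plane of order $\rho(f)\in(0,\infty)$, the ray $\arg z=\theta_0$ is a Borel direction of $f$ (of order $\rho(f)$) if for every $\epsilon>0$ the equality $\limsup_{r\to\infty}\frac{\log n(\Omega(\theta_0-\epsilon,\theta_0+\epsilon,r),f=a)}{\log r}=\rho(f)$ holds for every complex number $a$ with at most two possible exceptions, where $n(\Omega(\theta_0-\epsilon,\theta_0+\epsilon,r),f=a)$ is the number of zeros, counted with multiplicity,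 of $f-a$ in $\{z:\theta_0-\epsilon<\arg z<\theta_0+\epsilon,\ |z|<r\}$. Yang's inequality: if $f$ is entire of order $\rho(f)\in(0,\infty)$, $p$ is the number of its finite deficient values and $q$ the number of its Borel directions, then $p\le q/2$. Such an $f$ is called extremal to Yang's inequality if $p=q/2$. (A finite value $a$ is deficient if its Nevanlinna deficiency $\delta(a,f)$ is positive.) *)

theory Defs
  imports "HOL-Complex_Analysis.Complex_Analysis"
begin

definition log_plus :: "real \<Rightarrow> real" where
  "log_plus x = max 0 (ln x)"

definition max_modulus :: "real \<Rightarrow> (complex \<Rightarrow> complex) \<Rightarrow> real" where
  "max_modulus r f = (SUP z\<in>sphere 0 r. norm (f z))"

definition entire_order :: "(complex \<Rightarrow> complex) \<Rightarrow> ereal" where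
  "entire_order f =
     Limsup at_top (\<lambda>r::real. ereal (log_plus (log_plus (max_modulus r f)) / ln r))"

text \<open>Infimum of the exponents for which the series over the zeros other than the origin,
  counted with multiplicity, converges; it is infinite if there is no such exponent.\<close>

definition zeros_exponent :: "(complex \<Rightarrow> complex) \<Rightarrow> ereal" where
  "zeros_exponent f =
     Inf {ereal s | s. 0 < s \<and>
       (\<lambda>z. real (nat (zorder f z)) * norm z powr (- s)) summable_on {z. z \<noteq> 0 \<and> f z = 0}}"

definition critical_ray :: "complex poly \<Rightarrow> real \<Rightarrow> bool" where
  "critical_ray P \<theta> \<longleftrightarrow> Re (lead_coeff P * exp (\<i> * of_nat (degree P) * of_real \<theta>)) = 0"

text \<open>The argument is quantified over all its determinations, so that sectors crossing the
  branch cut of the principal argument need no special treatment.\<close>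

definition sector :: "real \<Rightarrow> real \<Rightarrow> real \<Rightarrow> complex set" where
  "sector \<alpha> \<beta> r = {rcis t \<phi> | t \<phi>. 0 < t \<and> t < r \<and> \<alpha> < \<phi> \<and> \<phi> < \<beta>}"

definition num_a_points :: "(complex \<Rightarrow> complex) \<Rightarrow> complex \<Rightarrow> complex set \<Rightarrow> nat" where
  "num_a_points f a S = (\<Sum>z | z \<in> S \<and> f z = a. nat (zorder (\<lambda>w. f w - a) z))"

text \<open>Meant for functions of positive finite order. The value \<open>ln 0 = 0\<close> is then
  harmless: an \<open>a\<close> that is not taken in the sector does not attain the order.\<close>

definition borel_direction :: "(complex \<Rightarrow> complex) \<Rightarrow> real \<Rightarrow> bool" where
  "borel_direction f \<theta> \<longleftrightarrow>
     (\<forall>\<epsilon>>0. \<exists>E. finite E \<and> card E \<le> 2 \<and>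
       (\<forall>a. a \<notin> E \<longrightarrow>
         Limsup at_top (\<lambda>r::real.
           ereal (ln (real (num_a_points f a (sector (\<theta> - \<epsilon>) (\<theta> + \<epsilon>) r))) / ln r))
         = entire_order f))"

definition proximity :: "real \<Rightarrow> (complex \<Rightarrow> complex) \<Rightarrow> real" where
  "proximity r f = integral {0..2 * pi} (\<lambda>\<theta>. log_plus (norm (f (rcis r \<theta>)))) / (2 * pi)"

text \<open>For entire functions the characteristic \<open>T(r,f) = m(r,f) + N(r,f)\<close> reduces to the
  proximity function \<open>m(r,f)\<close>, since there are no poles.\<close>

definition nevanlinna_char :: "real \<Rightarrow> (complex \<Rightarrow> complex) \<Rightarrow> real" where
  "nevanlinna_char r f = proximity r f"

definition deficiency :: "complex \<Rightarrow> (complex \<Rightarrow> complex) \<Rightarrow> ereal" where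
  "deficiency a f =
     Liminf at_top (\<lambda>r::real. ereal (proximity r (\<lambda>z. 1 / (f z - a)) / nevanlinna_char r f))"

definition deficient_values :: "(complex \<Rightarrow> complex) \<Rightarrow> complex set" where
  "deficient_values f = {a. 0 < deficiency a f}"

definition borel_directions :: "(complex \<Rightarrow> complex) \<Rightarrow> real set" where
  "borel_directions f = {\<theta>. 0 \<le> \<theta> \<and> \<theta> < 2 * pi \<and> borel_direction f \<theta>}"

text \<open>Both numbers in Yang's inequality are required to be finite; the equality
  \<open>p = q / 2\<close> is one between natural numbers.\<close>

definition yang_extremal :: "(complex \<Rightarrow> complex) \<Rightarrow> bool" where
  "yang_extremal f \<longleftrightarrow>
     f holomorphic_on UNIV \<and> 0 < entire_order f \<and> entire_order f < \<infinity> \<and>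
     finite (deficient_values f) \<and> finite (borel_directions f) \<and>
     real (card (deficient_values f)) = real (card (borel_directions f)) / 2"

end

theory Submission
  imports Defs "HOL-Real_Asymp.Real_Asymp"
begin

text \<open>
  Let \<open>n\<close> be the degree of \<open>P\<close> and \<open>\<rho>\<close> the order of \<open>B\<close>, and suppose that some solution \<open>f \<noteq> 0\<close> has
  finite order. The contradiction is that \<open>B\<close> then grows with an exponent less than \<open>\<rho>\<close> in every
  direction; call such a direction slow. By compactness of the circle a function all of whose
  directions are slow has order less than \<open>\<rho>\<close> (\<open>order_less_if_all_directions_slow\<close>).

  Solving the equation for the last coefficient gives \<open>B = - f''/f - A f'/f\<close>. As \<open>f\<close> has finite
  order, \<open>f'/f\<close> and \<open>f''/f\<close> grow at most like a power of \<open>R\<close> on suitable circles of radius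
  comparable to \<open>R\<close>, wherever their centres lie in the disc of radius \<open>R\<close>
  (\<open>log_derivative_on_circles\<close>). So \<open>B\<close> is controlled by \<open>A\<close>. On circles about the origin this
  yields \<open>\<rho> \<le> n\<close>. On circles about a point of a ray on which the leading term of \<open>P\<close> has negative
  real part, \<open>A\<close> is bounded because the order of \<open>v\<close> is less than \<open>n\<close>; there \<open>B\<close> grows like a
  power at most, and these directions, which fill \<open>n\<close> open sectors of opening \<open>\<pi>/n\<close>, are slow.

  A critical ray bounds one of those sectors and is not a Borel direction of \<open>B\<close>, so two values
  \<open>a\<close> are taken rarely in a sector around it. For one of them \<open>B - a\<close> is not small at the centre of
  a disc centred on the slow side of the ray. After division by its zeros \<open>B - a\<close> has a holomorphic
  logarithm, which is small on a small concentric disc; interpolation between concentric discs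
  carries the bound across the ray (\<open>small_near_one_of_two_values\<close>, \<open>slow_direction_spreads\<close>).
  Hence critical rays are slow as well.

  Every other direction lies between two critical rays at distance \<open>\<pi>/n\<close>. Slowness being an open
  condition, it lies in a sector of opening strictly less than \<open>\<pi>/n \<le> \<pi>/\<rho>\<close> with slow edges, and
  the Phragmen-Lindeloef principle makes it slow (\<open>slow_direction_between\<close>).
\<close>

section \<open>Factoring out zeros of entire functions\<close>

lemma entire_factor_zero:
  fixes h :: "complex \<Rightarrow> complex"
  assumes h: "h holomorphic_on UNIV" and nz: "\<exists>z. h z \<noteq> 0"
  obtains k h' where "h' holomorphic_on UNIV" "h' w \<noteq> 0" "\<And>z. h z = h' z * (z - w) ^ k"
proof -
  define n where "n = nat (zorder h w)"
  define p where "p = zor_poly h w"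
  have "\<exists>r. r > 0 \<and> p holomorphic_on cball w r \<and>
          (\<forall>z\<in>cball w r. h z = p z * (z - w) ^ n \<and> p z \<noteq> 0)"
    using zorder_exist_zero[of h UNIV w] h nz unfolding n_def p_def by auto
  then obtain r where r: "r > 0" "p holomorphic_on cball w r"
      "\<And>z. z \<in> cball w r \<Longrightarrow> h z = p z * (z - w) ^ n \<and> p z \<noteq> 0"
    by auto
  define h' where "h' z = (if z = w then p w else h z / (z - w) ^ n)" for z
  have eq: "h' z = p z" if "z \<in> ball w r" for z
    using r(3)[of z] that by (auto simp: h'_def)
  have "p holomorphic_on ball w r"
    using r(2) by (rule holomorphic_on_subset) auto
  then have 1: "h' holomorphic_on ball w r"
    using eq by (metis holomorphic_transform)
  have "(\<lambda>z. h z / (z - w) ^ n) holomorphic_on - {w}"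
    using h by (intro holomorphic_intros) (auto elim: holomorphic_on_subset)
  then have 2: "h' holomorphic_on - {w}"
    by (rule holomorphic_transform) (auto simp: h'_def)
  have "h' holomorphic_on (ball w r \<union> - {w})"
    using 1 2 by (intro holomorphic_on_Un) auto
  moreover have "ball w r \<union> - {w} = UNIV"
    using r(1) by auto
  ultimately have "h' holomorphic_on UNIV"
    by simp
  moreover have "h' w \<noteq> 0"
    using r by (simp add: h'_def)
  moreover have "h z = h' z * (z - w) ^ n" for z
    using r(1) r(3)[of w] by (auto simp: h'_def)
  ultimately show ?thesis
    using that by blast
qed

lemma holomorphic_on_root_prod [holomorphic_intros]:
  "(\<lambda>z. \<Prod>w\<leftarrow>ws. z - w) holomorphic_on S" for ws :: "complex list"
  by (induction ws) (auto intro!: holomorphic_intros)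

lemma root_prod_eq_0_iff: "(\<Prod>w\<leftarrow>ws. z - w) = 0 \<longleftrightarrow> z \<in> set ws" for ws :: "complex list"
  by (induction ws) auto

lemma norm_root_prod_le:
  fixes ws :: "complex list"
  assumes "\<And>w. w \<in> set ws \<Longrightarrow> norm (z - w) \<le> b"
  shows "norm (\<Prod>w\<leftarrow>ws. z - w) \<le> b ^ length ws"
  using assms by (induction ws) (auto simp: norm_mult intro!: mult_mono order_trans[OF norm_ge_zero])

lemma norm_root_prod_ge:
  fixes ws :: "complex list"
  assumes "\<And>w. w \<in> set ws \<Longrightarrow> b \<le> norm (z - w)" and "0 \<le> b"
  shows "b ^ length ws \<le> norm (\<Prod>w\<leftarrow>ws. z - w)"
  using assms by (induction ws) (auto simp: norm_mult intro!: mult_mono)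

lemma root_prod_rescale:
  fixes ws :: "complex list"
  assumes "R \<noteq> 0"
  shows "(\<Prod>w\<leftarrow>ws. (c + R * z) - w) = R ^ length ws * (\<Prod>w\<leftarrow>map (\<lambda>w. (w - c) / R) ws. z - w)"
  using assms by (induction ws) (auto simp: field_simps)

lemma finite_entire_zeros:
  fixes g :: "complex \<Rightarrow> complex"
  assumes "g holomorphic_on UNIV" "\<exists>z. g z \<noteq> 0" "bounded S"
  shows "finite {z \<in> S. g z = 0}"
proof -
  have "finite {z \<in> closure S. g z = 0}"
  proof (cases "g constant_on UNIV")
    case True
    then have "{z \<in> closure S. g z = 0} = {}"
      using assms(2) by (auto simp: constant_on_def)
    then show ?thesis
      by (metis finite.emptyI)
  next
    case False
    then show ?thesis
      using assms by (intro holomorphic_compact_finite_zeros[of g UNIV])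
        (auto simp: compact_closure constant_on_def connected_UNIV)
  qed
  then show ?thesis
    by (rule rev_finite_subset) (use closure_subset in auto)
qed

text \<open>The zeros come as a list with repetitions: bounds for the polynomial \<open>\<Prod>(z - w)\<close> are then powers of
bounds for a single factor, with the length of the list, which is the number of zeros counted with
multiplicity, as exponent.\<close>

lemma entire_factor_zeros:
  fixes g :: "complex \<Rightarrow> complex"
  assumes g: "g holomorphic_on UNIV" and nz: "\<exists>z. g z \<noteq> 0" and S: "bounded S"
  obtains h ws where "h holomorphic_on UNIV" "\<And>z. z \<in> S \<Longrightarrow> h z \<noteq> 0" "set ws \<subseteq> S"
    "length ws = (\<Sum>z | z \<in> S \<and> g z = 0. nat (zorder g z))"
    "\<And>z. g z = h z * (\<Prod>w\<leftarrow>ws. z - w)"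
proof -
  have *: "\<exists>h ws. h holomorphic_on UNIV \<and> (\<forall>z\<in>Z. h z \<noteq> 0) \<and> set ws \<subseteq> Z \<and>
      length ws = (\<Sum>z\<in>Z. nat (zorder g z)) \<and> (\<forall>z. g z = h z * (\<Prod>w\<leftarrow>ws. z - w))"
    if "finite Z" for Z
    using that
  proof induction
    case empty
    show ?case
      by (rule exI[of _ g], rule exI[of _ "[]"]) (use g in auto)
  next
    case (insert x Z)
    then obtain h ws where h: "h holomorphic_on UNIV" "\<forall>z\<in>Z. h z \<noteq> 0" "set ws \<subseteq> Z"
      "length ws = (\<Sum>z\<in>Z. nat (zorder g z))" "\<forall>z. g z = h z * (\<Prod>w\<leftarrow>ws. z - w)"
      by blast
    have "\<exists>z. h z \<noteq> 0"
      using nz h(5) by (metis mult_zero_left)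
    then obtain k h' where h': "h' holomorphic_on UNIV" "h' x \<noteq> 0" "\<And>z. h z = h' z * (z - x) ^ k"
      using entire_factor_zero[OF h(1)] by metis
    have "zorder g x = int k"
    proof (rule zorder_eqI[of UNIV x "\<lambda>z. h' z * (\<Prod>w\<leftarrow>ws. z - w)"])
      show "(\<lambda>z. h' z * (\<Prod>w\<leftarrow>ws. z - w)) holomorphic_on UNIV"
        using h' by (intro holomorphic_intros)
      show "h' x * (\<Prod>w\<leftarrow>ws. x - w) \<noteq> 0"
        using h'(2) h(3) insert.hyps by (auto simp: root_prod_eq_0_iff)
    qed (use h h' in auto)
    then have "length (replicate k x @ ws) = (\<Sum>z\<in>insert x Z. nat (zorder g z))"
      using insert.hyps h(4) by simp
    moreover have "(\<Prod>w\<leftarrow>replicate k x @ ws. z - w) = (z - x) ^ k * (\<Prod>w\<leftarrow>ws. z - w)" for z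
      by simp
    then have "\<forall>z. g z = h' z * (\<Prod>w\<leftarrow>replicate k x @ ws. z - w)"
      using h(5) h'(3) by (simp add: mult_ac)
    moreover have "\<forall>z\<in>insert x Z. h' z \<noteq> 0"
      using h(2) h' by auto
    moreover have "set (replicate k x @ ws) \<subseteq> insert x Z"
      using h(3) by auto
    ultimately show ?case
      using h'(1) by blast
  qed
  obtain h ws where h: "h holomorphic_on UNIV" "\<forall>z\<in>{z. z \<in> S \<and> g z = 0}. h z \<noteq> 0"
      "set ws \<subseteq> {z. z \<in> S \<and> g z = 0}"
      "length ws = (\<Sum>z | z \<in> S \<and> g z = 0. nat (zorder g z))"
      "\<forall>z. g z = h z * (\<Prod>w\<leftarrow>ws. z - w)"
    using *[OF finite_entire_zeros[OF g nz S]] by blast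
  show ?thesis
  proof (rule that[of h ws])
    show "h z \<noteq> 0" if "z \<in> S" for z
      using h(2,5) that by fastforce
  qed (use h in auto)
qed

lemma num_a_points_mono:
  assumes f: "f holomorphic_on UNIV" "\<exists>z. f z \<noteq> a" and "S \<subseteq> T" "bounded T"
  shows "num_a_points f a S \<le> num_a_points f a T"
  unfolding num_a_points_def
proof (rule sum_mono2)
  have "finite {z \<in> T. f z - a = 0}"
    using assms by (intro finite_entire_zeros) (auto intro!: holomorphic_intros)
  then show "finite {z \<in> T. f z = a}"
    by simp
qed (use assms in auto)

lemma entire_factor_a_points:
  assumes f: "f holomorphic_on UNIV" "\<exists>z. f z \<noteq> a" and T: "bounded T"
  obtains h ws where "h holomorphic_on UNIV" "\<And>z. z \<in> T \<Longrightarrow> h z \<noteq> 0" "set ws \<subseteq> T"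
    "length ws = num_a_points f a T" "\<And>z. f z - a = h z * (\<Prod>w\<leftarrow>ws. z - w)"
proof -
  have 1: "(\<lambda>z. f z - a) holomorphic_on UNIV"
    using f by (intro holomorphic_intros)
  have 2: "\<exists>z. f z - a \<noteq> 0"
    using f by simp
  obtain h ws where h: "h holomorphic_on UNIV" "\<And>z. z \<in> T \<Longrightarrow> h z \<noteq> 0" "set ws \<subseteq> T"
    and len: "length ws = (\<Sum>z | z \<in> T \<and> f z - a = 0. nat (zorder (\<lambda>z. f z - a) z))"
    and eq: "\<And>z. f z - a = h z * (\<Prod>w\<leftarrow>ws. z - w)"
    using entire_factor_zeros[OF 1 2 T] by blast
  have "length ws = num_a_points f a T"
    using len by (simp only: num_a_points_def right_minus_eq)
  from that[OF h this eq] show ?thesis .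
qed

section \<open>Bounds for holomorphic functions on concentric discs\<close>

lemma max_modulus_cball:
  fixes f :: "complex \<Rightarrow> complex"
  assumes "f holomorphic_on UNIV" "\<And>z. norm (z - c) = r \<Longrightarrow> norm (f z) \<le> M"
    and "norm (z - c) \<le> r" 
  shows "norm (f z) \<le> M"
proof (cases "r > 0")
  case True
  show ?thesis
  proof (rule maximum_modulus_frontier[of f "cball c r"])
    show "f holomorphic_on interior (cball c r)" "continuous_on (closure (cball c r)) f"
      using assms(1) by (auto intro: holomorphic_on_imp_continuous_on holomorphic_on_subset)
    show "norm (f z) \<le> M" if "z \<in> frontier (cball c r)" for z
      using that assms(2)[of z] True by (auto simp: dist_norm norm_minus_commute)
  qed (use assms in \<open>auto simp: dist_norm norm_minus_commute\<close>)
next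
  case False
  then have "norm (z - c) = r"
    using assms(3) norm_ge_zero[of "z - c"] by linarith
  then show ?thesis
    using assms(2) by blast
qed

text \<open>For \<open>A' > A\<close> the map \<open>u \<mapsto> u / (2 A' - u)\<close> sends the half-plane \<open>Re u < A'\<close> into the unit disc and
fixes the origin, so Schwarz' lemma applies to its composition with \<open>H\<close>; then \<open>A'\<close> tends to \<open>A\<close>.\<close>

lemma Borel_Caratheodory:
  fixes H :: "complex \<Rightarrow> complex"
  assumes H: "H holomorphic_on ball c R" and "H c = 0"
    and Re: "\<And>z. z \<in> ball c R \<Longrightarrow> Re (H z) \<le> A"
    and z: "norm (z - c) \<le> r" and r: "r < R" 
  shows "norm (H z) \<le> 2 * A * r / (R - r)"
proof -
  have R: "R > 0" "0 \<le> r"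
    using z r norm_ge_zero[of "z - c"] by linarith+
  have A0: "A \<ge> 0"
    using Re[of c] R assms(2) by simp
  have bound: "norm (H z) \<le> 2 * A' * r / (R - r)" if A': "A' > A" for A'
  proof -
    define g where "g w = H (c + R * w) / (2 * A' - H (c + R * w))" for w :: complex
    have inb: "c + R * w \<in> ball c R" if "norm w < 1" for w :: complex
      using that R by (simp add: dist_norm norm_mult)
    have ReA: "Re (H (c + R * w)) < A'" if "norm w < 1" for w :: complex
      using Re[OF inb[OF that]] A' by linarith
    have nz: "2 * A' - H (c + R * w) \<noteq> 0" if "norm w < 1" for w :: complex
      using ReA[OF that] A0 A' by (auto simp: complex_eq_iff)
    have "(\<lambda>w. H (c + R * w)) holomorphic_on ball 0 1"
      using inb by (intro holomorphic_on_compose_gen[OF _ H, unfolded o_def] holomorphic_intros) auto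
    then have g: "g holomorphic_on ball 0 1"
      unfolding g_def using nz by (intro holomorphic_intros) auto
    have gl: "norm (g w) < 1" if "norm w < 1" for w :: complex
    proof -
      define u where "u = H (c + R * w)"
      have "Re u < A'" using ReA[OF that] by (simp add: u_def)
      then have "A' * Re u < A' * A'" using A0 A' by simp
      then have "(norm u)\<^sup>2 < (norm (2 * A' - u))\<^sup>2"
        unfolding cmod_power2 by (simp add: power2_eq_square algebra_simps)
      then have "norm u < norm (2 * A' - u)"
        by (rule power_less_imp_less_base) simp
      then show ?thesis
        unfolding g_def u_def[symmetric] norm_divide using nz[OF that] u_def
        by (simp add: divide_simps)
    qed
    define w where "w = (z - c) / R"
    have w: "norm w \<le> r / R" "norm w < 1"
      using z r R by (simp_all add: w_def norm_divide divide_simps)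
    have zw: "c + R * w = z"
      using R by (simp add: w_def)
    have "norm (g w) \<le> norm w"
      using Schwarz_Lemma(1)[OF g _ gl w(2)] assms(2) by (simp add: g_def)
    then have "norm (H z) / norm (2 * A' - H z) \<le> r / R"
      using w zw by (simp add: g_def norm_divide)
    moreover have "norm (2 * A' - H z) > 0"
      using nz[OF w(2)] zw by simp
    ultimately have "norm (H z) * R \<le> r * norm (2 * A' - H z)"
      using R by (simp add: divide_simps mult_ac)
    also have "\<dots> \<le> r * (2 * A' + norm (H z))"
      using R A0 A' norm_triangle_ineq4[of "2 * of_real A'" "H z"] by (intro mult_left_mono) auto
    finally have "norm (H z) * (R - r) \<le> 2 * A' * r"
      by (simp add: algebra_simps)
    then show ?thesis
      using r by (simp add: divide_simps)
  qed
  have "((\<lambda>A'. 2 * A' * r / (R - r)) \<longlongrightarrow> 2 * A * r / (R - r)) (at_right A)"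
    using r by (intro tendsto_intros) auto
  then show ?thesis
    by (rule tendsto_lowerbound) (auto simp: eventually_at_right_less bound intro!: eventually_mono[OF eventually_at_right_less])
qed

text \<open>Cauchy's inequalities on two circles bound each Taylor coefficient both through \<open>m\<close> and through
\<open>L\<close>, hence by the product of the powers \<open>t\<close> and \<open>1 - t\<close> of the two bounds. For small \<open>t\<close> the
resulting series on the circle of radius \<open>r2\<close> is geometric with ratio \<open>q < 1\<close>. This is a weak
form of Hadamard's three circles theorem; what matters is that \<open>t\<close> and \<open>K\<close> serve all functions.\<close>

lemma three_circles:
  fixes r1 r2 r3 :: real
  assumes "0 < r1" "r1 < r2" "r2 < r3"
  shows "\<exists>t K. 0 < t \<and> t < 1 \<and> 1 \<le> K \<and> (\<forall>F m L. F holomorphic_on ball 0 r3 \<longrightarrow> 0 < m \<longrightarrow> 0 < L \<longrightarrow>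
      (\<forall>z. norm z < r1 \<longrightarrow> norm (F z) \<le> m) \<longrightarrow> (\<forall>z. norm z < r3 \<longrightarrow> norm (F z) \<le> L) \<longrightarrow>
      (\<forall>z. norm z \<le> r2 \<longrightarrow> norm (F z) \<le> K * m powr t * L powr (1 - t)))"
proof -
  define s1 where "s1 = r1 / 2"
  define s3 where "s3 = (r2 + r3) / 2"
  have s: "0 < s1" "s1 < r1" "r2 < s3" "s3 < r3" "s1 < s3"
    using assms by (auto simp: s1_def s3_def)
  define t where "t = (ln s3 - ln r2) / (2 * (ln s3 - ln s1))"
  have ln: "ln s3 - ln r2 > 0" "ln r2 - ln s1 > 0"
    using s assms by simp_all
  have t: "0 < t" "t < 1"
    using ln unfolding t_def by (auto simp: divide_simps)
  define q where "q = r2 / (s1 powr t * s3 powr (1 - t))"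
  have "ln q = ln r2 - (t * ln s1 + (1 - t) * ln s3)"
    using s assms by (simp add: q_def ln_div ln_mult ln_powr)
  also have "\<dots> = - (ln s3 - ln r2) + t * (ln s3 - ln s1)"
    by (simp add: algebra_simps)
  also have "\<dots> = - (ln s3 - ln r2) / 2"
    using ln by (simp add: t_def divide_simps) (simp add: algebra_simps)
  finally have "ln q < 0"
    using ln by simp
  moreover have "q > 0"
    using s assms by (simp add: q_def)
  ultimately have q: "0 < q" "q < 1"
    by auto
  define K where "K = 1 / (1 - q)"
  have K: "1 \<le> K"
    using q by (simp add: K_def)
  show ?thesis
  proof (rule exI[of _ t], rule exI[of _ K], intro conjI allI impI)
    fix F :: "complex \<Rightarrow> complex" and m L :: real and z :: complex
    assume F: "F holomorphic_on ball 0 r3" and mL: "0 < m" "0 < L"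
      and mle: "\<forall>z. norm z < r1 \<longrightarrow> norm (F z) \<le> m"
      and Lle: "\<forall>z. norm z < r3 \<longrightarrow> norm (F z) \<le> L" and z: "norm z \<le> r2"
    define a where "a n = (deriv ^^ n) F 0 / fact n" for n
    have sums: "(\<lambda>n. a n * z ^ n) sums F z"
      using holomorphic_power_series[OF F, of z] z assms by (simp add: a_def)
    have coeff: "norm (a n) * s ^ n \<le> M"
      if "0 < s" "s < r3" "\<And>z. norm z = s \<Longrightarrow> norm (F z) \<le> M" for n s M
    proof -
      have "norm ((deriv ^^ n) F 0) \<le> fact n * M / s ^ n"
      proof (rule Cauchy_inequality)
        show "F holomorphic_on ball 0 s" "continuous_on (cball 0 s) F"
          using F that(2) by (auto intro!: holomorphic_on_imp_continuous_on elim!: holomorphic_on_subset)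
      qed (use that in auto)
      then show ?thesis
        using that(1) by (simp add: a_def norm_divide divide_simps mult_ac)
    qed
    have coeff_le: "norm (a n * z ^ n) \<le> m powr t * L powr (1 - t) * q ^ n" for n
    proof -
      define c where "c = norm (a n)"
      have c1: "c * s1 ^ n \<le> m" and c3: "c * s3 ^ n \<le> L"
        unfolding c_def using s assms by (auto intro!: coeff simp: mle Lle)
      have pw: "(x ^ n) powr y = (x powr y) ^ n" if "x > 0" for x y :: real
        using that by (simp add: powr_powr mult.commute flip: powr_realpow)
      have "c * (s1 powr t * s3 powr (1 - t)) ^ n = (c * s1 ^ n) powr t * (c * s3 ^ n) powr (1 - t)"
        using s by (auto simp: powr_mult pw c_def power_mult_distrib mult_ac simp flip: powr_add)
      also have "\<dots> \<le> m powr t * L powr (1 - t)"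
        using c1 c3 s t by (intro mult_mono powr_mono2) (auto simp: c_def)
      finally have *: "c * (s1 powr t * s3 powr (1 - t)) ^ n \<le> m powr t * L powr (1 - t)" .
      have "norm (a n * z ^ n) \<le> c * r2 ^ n"
        using z by (auto simp: norm_mult norm_power c_def intro!: mult_left_mono power_mono)
      also have "\<dots> = c * (s1 powr t * s3 powr (1 - t)) ^ n * q ^ n"
        using s by (simp add: q_def flip: power_mult_distrib)
      also have "\<dots> \<le> m powr t * L powr (1 - t) * q ^ n"
        using * q by (intro mult_right_mono) auto
      finally show ?thesis .
    qed
    have "(\<lambda>n. m powr t * L powr (1 - t) * q ^ n) sums (m powr t * L powr (1 - t) * (1 / (1 - q)))"
      using q by (intro sums_mult geometric_sums) auto
    then have "norm (F z) \<le> m powr t * L powr (1 - t) * (1 / (1 - q))"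
      using norm_suminf_le[of "\<lambda>n. a n * z ^ n", OF coeff_le] sums unfolding sums_iff by metis
    then show "norm (F z) \<le> K * m powr t * L powr (1 - t)"
      by (simp add: K_def mult_ac)
  qed (use t K in auto)
qed

text \<open>The form in which zero-free functions are fed into \<open>Borel_Caratheodory\<close>: a logarithm that vanishes at
the centre.\<close>

lemma holomorphic_normalized_log:
  fixes h :: "complex \<Rightarrow> complex"
  assumes "h holomorphic_on UNIV" "R > 0" "\<And>z. z \<in> ball c R \<Longrightarrow> h z \<noteq> 0"
  shows "\<exists>H. H holomorphic_on ball c R \<and> H c = 0 \<and> (\<forall>z\<in>ball c R. h z = h c * exp (H z) \<and>
    norm (h z) = norm (h c) * exp (Re (H z)))"
proof -
  have "h holomorphic_on ball c R"
    using assms(1) by (rule holomorphic_on_subset) simp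
  then obtain G where G: "G holomorphic_on ball c R" "\<And>z. z \<in> ball c R \<Longrightarrow> exp (G z) = h z"
    using holomorphic_logarithm_exists[of "ball c R" h c] assms by auto
  have eq: "h z = h c * exp (G z - G c)" if "z \<in> ball c R" for z
    using G(2)[OF that] G(2)[of c] assms(2) assms(3)[of c] by (simp add: exp_diff)
  have "norm (h z) = norm (h c) * exp (Re (G z - G c))" if "z \<in> ball c R" for z
    by (subst eq[OF that]) (simp add: norm_mult)
  then show ?thesis
    using eq G(1) by (intro exI[of _ "\<lambda>z. G z - G c"]) (auto intro!: holomorphic_intros)
qed

text \<open>How a function that rarely takes the values \<open>a1\<close> and \<open>a2\<close> is bounded on a large disc by its bound
\<open>exp m\<close> on a small concentric one: its a priori bound \<open>exp L\<close> improves to \<open>exp\<close> of an interpolated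
quantity. At the centre one of \<open>B - a1\<close>, \<open>B - a2\<close> has modulus at least \<open>\<bar>a1 - a2\<bar> / 2\<close>. Write
that function as \<open>h\<close> times the polynomial of its zeros, which are at most \<open>m\<close> in number and
therefore change the logarithm of the modulus by \<open>O(m)\<close> only. The logarithm of \<open>h\<close> is bounded
below at the centre by \<open>- O(m)\<close> and its real part is bounded above by \<open>O(m)\<close> on the small disc and
by \<open>O(L)\<close> on the large one. \<open>Borel_Caratheodory\<close> turns these into bounds for its modulus, to which
\<open>three_circles\<close> applies. Two values are needed because a function may well stay exponentially
close to a single value in one half of the disc and be large in the other half, as the exponential
function shows.\<close>

lemma small_near_one_of_two_values:
  fixes r1 r2 r3 r4 :: real and a1 a2 :: complex
  assumes r: "0 < r1" "r1 < r2" "r2 < r3" "r3 < r4" and a: "a1 \<noteq> a2"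
  shows "\<exists>t K. 0 < t \<and> t < 1 \<and> 0 < K \<and> (\<forall>B h1 h2 ws1 ws2 L m. B holomorphic_on UNIV \<longrightarrow>
       h1 holomorphic_on UNIV \<longrightarrow> h2 holomorphic_on UNIV \<longrightarrow> 1 \<le> m \<longrightarrow> m \<le> L \<longrightarrow>
       (\<forall>z. norm z \<le> r1 \<longrightarrow> norm (B z) \<le> exp m) \<longrightarrow> (\<forall>z. norm z \<le> r4 \<longrightarrow> norm (B z) \<le> exp L) \<longrightarrow>
       set ws1 \<subseteq> ball 0 r3 \<longrightarrow> set ws2 \<subseteq> ball 0 r3 \<longrightarrow> real (length ws1) \<le> m \<longrightarrow> real (length ws2) \<le> m \<longrightarrow>
       (\<forall>z. norm z < r3 \<longrightarrow> h1 z \<noteq> 0) \<longrightarrow> (\<forall>z. norm z < r3 \<longrightarrow> h2 z \<noteq> 0) \<longrightarrow>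
       (\<forall>z. B z - a1 = h1 z * (\<Prod>w\<leftarrow>ws1. z - w)) \<longrightarrow> (\<forall>z. B z - a2 = h2 z * (\<Prod>w\<leftarrow>ws2. z - w)) \<longrightarrow>
       (\<forall>z. norm z \<le> r2 \<longrightarrow> norm (B z) \<le> exp (K * m powr t * L powr (1 - t))))"
proof -
  \<comment> \<open>\<open>Borel_Caratheodory\<close> loses some of the radius, so the interpolation uses \<open>s3\<close> in place of \<open>r3\<close>.\<close>
  define s3 where "s3 = (r2 + r3) / 2"
  have s3: "r2 < s3" "s3 < r3" "0 < s3"
    using r by (auto simp: s3_def)
  have r14: "0 < r1 / 4" "r1 / 4 < r2"
    using r by auto
  obtain t K0 where t: "0 < t" "t < 1" "1 \<le> K0" and
    three: "\<forall>F m L. F holomorphic_on ball 0 s3 \<longrightarrow> 0 < m \<longrightarrow> 0 < L \<longrightarrow>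
      (\<forall>z. norm z < r1 / 4 \<longrightarrow> norm (F z) \<le> m) \<longrightarrow> (\<forall>z. norm z < s3 \<longrightarrow> norm (F z) \<le> L) \<longrightarrow>
      (\<forall>z. norm z \<le> r2 \<longrightarrow> norm (F z) \<le> K0 * m powr t * L powr (1 - t))"
    using three_circles[OF r14 s3(1)] by blast
  define A where "A = norm a1 + norm a2"
  define d where "d = norm (a1 - a2) / 2"
  define l where "l = \<bar>ln (r4 - r3)\<bar> + \<bar>ln (r1/4)\<bar> + \<bar>ln (2 * r3)\<bar>"
  define C where "C = 1 + ln (1 + A) + 2 * l + \<bar>ln d\<bar>"
  have d: "d > 0" and A: "A \<ge> 0" "ln (1 + A) \<ge> 0"
    using a by (auto simp: d_def A_def)
  have C: "C \<ge> 1" "l \<ge> 0"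
    using A by (auto simp: C_def l_def)
  define K1 where "K1 = 2 * (s3 / (r3 - s3)) + 2"
  have K1: "K1 \<ge> 2" "K1 > 0"
    using s3 by (auto simp: K1_def intro!: add_nonneg_pos)
  define K where "K = K0 * K1 * C + 4 * C"
  have expl: "x ^ n \<le> exp (l * m)" if "real n \<le> m" "0 < x" "ln x \<le> l" for x m :: real and n
  proof -
    have "x ^ n = exp (n * ln x)"
      using that by (simp add: exp_of_nat_mult)
    also have "n * ln x \<le> real n * l"
      using that by (intro mult_left_mono) auto
    also have "\<dots> \<le> l * m"
      using that C by (simp add: mult.commute[of l] mult_right_mono)
    finally show ?thesis by simp
  qed
  have main: "norm (B z) \<le> exp (K * m powr t * L powr (1 - t))"
    if B: "B holomorphic_on UNIV" and h: "h holomorphic_on UNIV" and m: "1 \<le> m" "m \<le> L"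
      and Bm: "\<And>z. norm z \<le> r1 \<Longrightarrow> norm (B z) \<le> exp m"
      and BL: "\<And>z. norm z \<le> r4 \<Longrightarrow> norm (B z) \<le> exp L"
      and ws: "set ws \<subseteq> ball 0 r3" "real (length ws) \<le> m" and hnz: "\<And>z. norm z < r3 \<Longrightarrow> h z \<noteq> 0"
      and eq: "\<And>z. B z - a = h z * (\<Prod>w\<leftarrow>ws. z - w)" and z: "norm z \<le> r2"
      and aA: "norm a \<le> A" and far: "d \<le> norm (B 0 - a)"
    for B h :: "complex \<Rightarrow> complex" and m L ws z a
  proof -
    have shift: "norm (B z - a) \<le> exp (M + ln (1 + A))" if "norm (B z) \<le> exp M" "M \<ge> 0" for z M
    proof -
      have "norm (B z - a) \<le> exp M + A"
        using that aA norm_triangle_ineq4[of "B z" a] by linarith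
      also have "\<dots> \<le> exp M * (1 + A)"
        using that A by (simp add: distrib_left mult_le_cancel_right1 mult_right_mono[of 1 "exp M" A, simplified])
      finally show ?thesis
        using A by (simp add: exp_add)
    qed
    have wsn: "norm w < r3" if "w \<in> set ws" for w
      using ws that by auto
    have hL: "norm (h z) \<le> exp (L + ln (1 + A) + l * m)" if "norm z \<le> r4" for z
    proof (rule max_modulus_cball[of h 0 r4])
      fix z :: complex
      assume z: "norm (z - 0) = r4"
      have "r4 - r3 \<le> norm (z - w)" if "w \<in> set ws" for w
        using wsn[OF that] z norm_triangle_ineq2[of z w] by simp
      then have P: "(r4 - r3) ^ length ws \<le> norm (\<Prod>w\<leftarrow>ws. z - w)"
        using r by (intro norm_root_prod_ge) auto
      have "norm (h z) * (r4 - r3) ^ length ws \<le> norm (h z) * norm (\<Prod>w\<leftarrow>ws. z - w)"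
        using P by (intro mult_left_mono) auto
      also have "\<dots> = norm (B z - a)"
        by (simp add: eq norm_mult)
      also have "\<dots> \<le> exp (L + ln (1 + A))"
        using BL z m by (intro shift) auto
      finally have "norm (h z) \<le> exp (L + ln (1 + A)) * (1 / (r4 - r3)) ^ length ws"
        using r by (simp add: divide_simps)
      also have "\<dots> \<le> exp (L + ln (1 + A)) * exp (l * m)"
        using r ws by (intro mult_left_mono expl) (auto simp: ln_div l_def)
      finally show "norm (h z) \<le> exp (L + ln (1 + A) + l * m)"
        by (simp add: exp_add)
    qed (use h that in auto)
    have hm: "norm (h z) \<le> exp (m + ln (1 + A) + l * m)" if z: "norm z \<le> r1 / 2" for z
    proof -
      \<comment> \<open>A zero may lie close to any given circle. Those below radius \<open>3 r1 / 4\<close> are divided out on the circle of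
        radius \<open>r1\<close>, the others on the disc of radius \<open>r1 / 2\<close>: all factors are then at least \<open>r1 / 4\<close>.\<close>
      define us where "us = filter (\<lambda>w. norm w < 3 * r1 / 4) ws"
      define vs where "vs = filter (\<lambda>w. \<not> norm w < 3 * r1 / 4) ws"
      have split: "(\<Prod>w\<leftarrow>ws. z - w) = (\<Prod>w\<leftarrow>us. z - w) * (\<Prod>w\<leftarrow>vs. z - w)" for z
        unfolding us_def vs_def by (induction ws) auto
      have len: "length ws = length us + length vs"
        unfolding us_def vs_def by (simp add: sum_length_filter_compl)
      have "norm (h z * (\<Prod>w\<leftarrow>vs. z - w)) \<le> exp (m + ln (1 + A)) * (1 / (r1 / 4)) ^ length us"
      proof (rule max_modulus_cball[of "\<lambda>z. h z * (\<Prod>w\<leftarrow>vs. z - w)" 0 r1])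
        show "(\<lambda>z. h z * (\<Prod>w\<leftarrow>vs. z - w)) holomorphic_on UNIV"
          using h by (intro holomorphic_intros)
        fix z :: complex
        assume z: "norm (z - 0) = r1"
        have "r1 / 4 \<le> norm (z - w)" if "w \<in> set us" for w
          using that z norm_triangle_ineq2[of z w] by (auto simp: us_def)
        then have P: "(r1 / 4) ^ length us \<le> norm (\<Prod>w\<leftarrow>us. z - w)"
          using r by (intro norm_root_prod_ge) auto
        have "norm (h z * (\<Prod>w\<leftarrow>vs. z - w)) * (r1 / 4) ^ length us
            \<le> norm (h z * (\<Prod>w\<leftarrow>vs. z - w)) * norm (\<Prod>w\<leftarrow>us. z - w)"
          using P by (intro mult_left_mono) auto
        also have "\<dots> = norm (B z - a)"
          by (simp add: eq norm_mult split)
        also have "\<dots> \<le> exp (m + ln (1 + A))"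
          using Bm z m by (intro shift) auto
        finally show "norm (h z * (\<Prod>w\<leftarrow>vs. z - w)) \<le> exp (m + ln (1 + A)) * (1 / (r1 / 4)) ^ length us"
          using r by (simp add: divide_simps)
      qed (use z r in auto)
      moreover have "(r1 / 4) ^ length vs \<le> norm (\<Prod>w\<leftarrow>vs. z - w)"
      proof (rule norm_root_prod_ge)
        fix w assume "w \<in> set vs"
        then show "r1 / 4 \<le> norm (z - w)"
          using z norm_triangle_ineq2[of w z] by (auto simp: vs_def norm_minus_commute)
      qed (use r in auto)
      then have "norm (h z) * (r1 / 4) ^ length vs \<le> norm (h z * (\<Prod>w\<leftarrow>vs. z - w))"
        by (auto simp: norm_mult intro!: mult_left_mono)
      ultimately have "norm (h z) * (r1 / 4) ^ length vs \<le> exp (m + ln (1 + A)) * (1 / (r1 / 4)) ^ length us"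
        by linarith
      then have "norm (h z) \<le> exp (m + ln (1 + A)) * (1 / (r1 / 4)) ^ length ws"
        using r by (simp add: divide_simps len power_add mult_ac)
      also have "\<dots> \<le> exp (m + ln (1 + A)) * exp (l * m)"
        using r ws by (intro mult_left_mono expl) (auto simp: ln_div l_def)
      finally show ?thesis
        by (simp add: exp_add)
    qed
    have h0: "exp (- \<bar>ln d\<bar> - l * m) \<le> norm (h 0)"
    proof -
      have "d \<le> norm (h 0) * norm (\<Prod>w\<leftarrow>ws. 0 - w)"
        using far by (simp add: eq norm_mult)
      also have "\<dots> \<le> norm (h 0) * (2 * r3) ^ length ws"
      proof (intro mult_left_mono norm_root_prod_le)
        fix w assume "w \<in> set ws"
        then show "norm (0 - w) \<le> 2 * r3" using wsn[of w] r by simp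
      qed auto
      also have "\<dots> \<le> norm (h 0) * exp (l * m)"
        using r ws by (intro mult_left_mono expl) (auto simp: l_def)
      finally have "d * exp (- (l * m)) \<le> norm (h 0)"
        by (simp add: exp_minus divide_simps)
      moreover have "exp (- \<bar>ln d\<bar>) \<le> exp (ln d)"
        by (subst exp_le_cancel_iff) simp
      then have "exp (- \<bar>ln d\<bar>) * exp (- (l * m)) \<le> d * exp (- (l * m))"
        using d by (intro mult_right_mono) auto
      ultimately have "exp (- \<bar>ln d\<bar>) * exp (- (l * m)) \<le> norm (h 0)"
        by linarith
      then show ?thesis
        by (simp flip: exp_add)
    qed
    have C_m: "m + ln (1 + A) + l * m + (\<bar>ln d\<bar> + l * m) \<le> C * m"
    proof -
      have "ln (1 + A) \<le> ln (1 + A) * m" "\<bar>ln d\<bar> \<le> \<bar>ln d\<bar> * m"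
        using m A mult_left_mono[of 1 m "ln (1 + A)"] mult_left_mono[of 1 m "\<bar>ln d\<bar>"] by auto
      then show ?thesis by (simp add: C_def algebra_simps)
    qed
    have C_L: "L + ln (1 + A) + l * m + (\<bar>ln d\<bar> + l * m) \<le> C * L"
    proof -
      have "ln (1 + A) \<le> ln (1 + A) * L" "\<bar>ln d\<bar> \<le> \<bar>ln d\<bar> * L" "l * m \<le> l * L"
        using m A C mult_left_mono[of 1 L "ln (1 + A)"] mult_left_mono[of 1 L "\<bar>ln d\<bar>"] mult_left_mono[of m L l]
        by auto
      then show ?thesis by (simp add: C_def algebra_simps)
    qed
    have r3: "r3 > 0"
      using r by simp
    have hnz': "h z \<noteq> 0" if "z \<in> ball 0 r3" for z
      using hnz[of z] that by simp
    obtain H where H: "H holomorphic_on ball 0 r3" "H 0 = 0"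
      "\<And>z. z \<in> ball 0 r3 \<Longrightarrow> norm (h z) = norm (h 0) * exp (Re (H z))"
      using holomorphic_normalized_log[OF h r3 hnz'] by blast
    have ReH: "Re (H z) \<le> M + (\<bar>ln d\<bar> + l * m)" if "norm z < r3" "norm (h z) \<le> exp M" for z M
    proof -
      have "exp (- \<bar>ln d\<bar> - l * m) * exp (Re (H z)) \<le> norm (h 0) * exp (Re (H z))"
        using h0 by (intro mult_right_mono) auto
      also have "\<dots> \<le> exp M"
        using H(3)[of z] that by simp
      finally show ?thesis
        by (simp flip: exp_add)
    qed
    have Hm: "norm (H z) \<le> K1 * (C * m)" if "norm z < r1 / 4" for z
    proof -
      have "norm (H z) \<le> 2 * (C * m) * (r1 / 4) / (r1 / 2 - r1 / 4)"
      proof (rule Borel_Caratheodory[of H 0])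
        show "H holomorphic_on ball 0 (r1 / 2)"
          using H(1) r by (auto elim!: holomorphic_on_subset)
        show "Re (H z) \<le> C * m" if "z \<in> ball 0 (r1 / 2)" for z
          using ReH[OF _ hm, of z] that r C_m by auto
      qed (use that r H in auto)
      also have "\<dots> = 2 * (C * m)"
        using r by (simp add: divide_simps)
      also have "\<dots> \<le> K1 * (C * m)"
        using K1 C m by (intro mult_right_mono) auto
      finally show ?thesis .
    qed
    have HL: "norm (H z) \<le> K1 * (C * L)" if "norm z < s3" for z
    proof -
      have "norm (H z) \<le> 2 * (C * L) * s3 / (r3 - s3)"
      proof (rule Borel_Caratheodory[of H 0])
        show "Re (H z) \<le> C * L" if "z \<in> ball 0 r3" for z
          using ReH[OF _ hL, of z] that r C_L by auto
      qed (use that s3 H in auto)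
      also have "\<dots> = (2 * (s3 / (r3 - s3))) * (C * L)"
        by simp
      also have "\<dots> \<le> K1 * (C * L)"
        using K1 C m by (intro mult_right_mono) (auto simp: K1_def)
      finally show ?thesis .
    qed
    define W where "W = m powr t * L powr (1 - t)"
    have W: "m \<le> W" "1 \<le> W"
    proof -
      have "m = m powr t * m powr (1 - t)"
        using m by (simp flip: powr_add)
      also have "\<dots> \<le> W"
        unfolding W_def using m t by (intro mult_left_mono powr_mono2) auto
      finally show "m \<le> W" "1 \<le> W" using m by auto
    qed
    have "norm (H z) \<le> K0 * (K1 * (C * m)) powr t * (K1 * (C * L)) powr (1 - t)"
      using K1 C m z H(1) s3 Hm HL by (intro three[rule_format]) (auto elim!: holomorphic_on_subset)
    also have "\<dots> = K0 * (K1 * C) * W"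
    proof -
      have "(K1 * (C * m)) powr t * (K1 * (C * L)) powr (1 - t) =
            ((K1 * C) powr t * (K1 * C) powr (1 - t)) * W"
      proof -
        have "(K1 * (C * x)) powr y = (K1 * C) powr y * x powr y" if "x \<ge> 0" for x y :: real
          using K1 C that powr_mult[of "K1 * C" x y] by (simp add: mult.assoc)
        from this[of m t] this[of L "1 - t"] show ?thesis
          using m by (simp add: W_def mult_ac)
      qed
      also have "(K1 * C) powr t * (K1 * C) powr (1 - t) = K1 * C"
        using K1 C by (simp flip: powr_add)
      finally show ?thesis by simp
    qed
    finally have Hz: "norm (H z) \<le> K0 * K1 * C * W" by simp
    have h00: "norm (h 0) \<le> exp (C * W)"
    proof -
      have "m + ln (1 + A) + l * m \<le> C * m"
        using C_m C m by (smt (verit) mult_nonneg_nonneg)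
      also have "\<dots> \<le> C * W"
        using W C by (intro mult_left_mono) auto
      finally show ?thesis
        using hm[of 0] r by (smt (verit) exp_le_cancel_iff norm_zero divide_nonneg_nonneg)
    qed
    have "norm (\<Prod>w\<leftarrow>ws. z - w) \<le> (2 * r3) ^ length ws"
    proof (rule norm_root_prod_le)
      fix w assume "w \<in> set ws"
      then show "norm (z - w) \<le> 2 * r3"
        using wsn[of w] z r norm_triangle_ineq4[of z w] by simp
    qed
    also have "\<dots> \<le> exp (l * m)"
      using r ws by (intro expl) (auto simp: l_def)
    also have "\<dots> \<le> exp (C * W)"
    proof (subst exp_le_cancel_iff, rule mult_mono)
      show "l \<le> C" using A C by (simp add: C_def)
    qed (use W C m in auto)
    finally have P: "norm (\<Prod>w\<leftarrow>ws. z - w) \<le> exp (C * W)" .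
    have "norm (h z) = norm (h 0) * exp (Re (H z))"
      using H(3)[of z] z r by simp
    also have "\<dots> \<le> exp (C * W) * exp (K0 * K1 * C * W)"
      using h00 Hz complex_Re_le_cmod[of "H z"] by (intro mult_mono) auto
    finally have hz: "norm (h z) \<le> exp (C * W) * exp (K0 * K1 * C * W)" .
    have "norm (B z) \<le> norm (B z - a) + norm a"
      using norm_triangle_ineq[of "B z - a" a] by simp
    also have "norm (B z - a) \<le> (exp (C * W) * exp (K0 * K1 * C * W)) * exp (C * W)"
      unfolding eq norm_mult by (intro mult_mono hz P) auto
    also have "\<dots> = exp (K0 * K1 * C * W + 2 * C * W)"
      by (simp add: algebra_simps flip: exp_add)
    also have "norm a \<le> exp (C * W) * exp (K0 * K1 * C * W + 2 * C * W)"
    proof -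
      have "norm a \<le> exp (ln (1 + A))"
        using aA A by simp
      also have "ln (1 + A) \<le> C * 1"
        using C by (simp add: C_def)
      also have "\<dots> \<le> C * W"
        using C W by (intro mult_left_mono) auto
      finally have "norm a \<le> exp (C * W)" by simp
      also have "\<dots> \<le> exp (C * W) * exp (K0 * K1 * C * W + 2 * C * W)"
        using C W K1 t by (simp add: mult_le_cancel_left1)
      finally show ?thesis .
    qed
    also have "exp (K0 * K1 * C * W + 2 * C * W) + exp (C * W) * exp (K0 * K1 * C * W + 2 * C * W)
        = (1 + exp (C * W)) * exp (K0 * K1 * C * W + 2 * C * W)"
      by (simp add: algebra_simps)
    also have "\<dots> \<le> exp (2 * C * W) * exp (K0 * K1 * C * W + 2 * C * W)"
    proof (rule mult_right_mono)
      have "1 \<le> C * W"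
        using mult_mono[of 1 C 1 W] C W by simp
      then have "2 \<le> exp (C * W)"
        using exp_ge_add_one_self[of "C * W"] by linarith
      then have "1 + exp (C * W) \<le> exp (C * W) * exp (C * W)"
        using mult_right_mono[of 2 "exp (C * W)" "exp (C * W)"] by linarith
      then show "1 + exp (C * W) \<le> exp (2 * C * W)"
        by (simp add: algebra_simps flip: exp_add)
    qed auto
    also have "\<dots> = exp (K * W)"
      by (simp add: K_def algebra_simps flip: exp_add)
    finally show ?thesis
      by (simp add: W_def mult_ac)
  qed
  show ?thesis
  proof (rule exI[of _ t], rule exI[of _ K], intro conjI allI impI)
    show "0 < K"
      using K1 C t by (auto simp: K_def intro!: add_nonneg_pos)
    fix B h1 h2 :: "complex \<Rightarrow> complex" and ws1 ws2 :: "complex list" and L m :: real and z :: complex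
    assume *: "B holomorphic_on UNIV" "h1 holomorphic_on UNIV" "h2 holomorphic_on UNIV"
       "1 \<le> m" "m \<le> L"
       "\<forall>z. norm z \<le> r1 \<longrightarrow> norm (B z) \<le> exp m" "\<forall>z. norm z \<le> r4 \<longrightarrow> norm (B z) \<le> exp L"
       "set ws1 \<subseteq> ball 0 r3" "set ws2 \<subseteq> ball 0 r3" "real (length ws1) \<le> m" "real (length ws2) \<le> m"
       "\<forall>z. norm z < r3 \<longrightarrow> h1 z \<noteq> 0" "\<forall>z. norm z < r3 \<longrightarrow> h2 z \<noteq> 0"
       "\<forall>z. B z - a1 = h1 z * (\<Prod>w\<leftarrow>ws1. z - w)" "\<forall>z. B z - a2 = h2 z * (\<Prod>w\<leftarrow>ws2. z - w)"
       "norm z \<le> r2"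
    have "norm (a1 - a2) \<le> norm (B 0 - a1) + norm (B 0 - a2)"
      using norm_triangle_ineq4[of "B 0 - a2" "B 0 - a1"] by simp
    then consider "d \<le> norm (B 0 - a1)" | "d \<le> norm (B 0 - a2)"
      unfolding d_def by linarith
    then show "norm (B z) \<le> exp (K * m powr t * L powr (1 - t))"
    proof cases
      case 1
      show ?thesis
        by (rule main[of B h1 m L ws1 a1 z]) (use * 1 in \<open>auto simp: A_def\<close>)
    next
      case 2
      show ?thesis
        by (rule main[of B h2 m L ws2 a2 z]) (use * 2 in \<open>auto simp: A_def\<close>)
    qed
  qed (use t in auto)
qed

section \<open>Logarithmic derivatives\<close>

text \<open>With \<open>f = f(z) exp G\<close> near \<open>z\<close>, the quotients \<open>f'/f\<close> and \<open>f''/f\<close> at \<open>z\<close> are \<open>G'\<close> and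
\<open>G'' + G'\<^sup>2\<close>; the real part of \<open>G\<close> is at most \<open>M\<close>, so that \<open>Borel_Caratheodory\<close> and
Cauchy's inequalities bound the derivatives of \<open>G\<close>.\<close>

lemma log_derivative_bounds:
  fixes f :: "complex \<Rightarrow> complex"
  assumes f: "f holomorphic_on UNIV" and r: "r > 0" and nz: "\<And>w. w \<in> ball z r \<Longrightarrow> f w \<noteq> 0"
    and le: "\<And>w. w \<in> ball z r \<Longrightarrow> norm (f w) \<le> exp M * norm (f z)"
  shows "norm (deriv f z) \<le> 4 * M / r * norm (f z)"
    and "norm (deriv (deriv f) z) \<le> (16 * M / r\<^sup>2 + (4 * M / r)\<^sup>2) * norm (f z)"
proof -
  obtain G where G: "G holomorphic_on ball z r" "G z = 0"
      "\<And>w. w \<in> ball z r \<Longrightarrow> f w = f z * exp (G w)"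
      "\<And>w. w \<in> ball z r \<Longrightarrow> norm (f w) = norm (f z) * exp (Re (G w))"
    using holomorphic_normalized_log[OF f r nz] by blast
  have fz: "f z \<noteq> 0"
    using nz r by simp
  have Re: "Re (G w) \<le> M" if "w \<in> ball z r" for w
    using le[OF that] G(4)[OF that] fz by simp
  have Gle: "norm (G w) \<le> 2 * M" if "norm (w - z) \<le> r / 2" for w
  proof -
    have "norm (G w) \<le> 2 * M * (r / 2) / (r - r / 2)"
      by (rule Borel_Caratheodory[OF G(1,2) Re that]) (use r in simp_all)
    then show ?thesis
      using r by (simp add: divide_simps)
  qed
  have Cauchy: "norm ((deriv ^^ n) G z) \<le> fact n * (2 * M) / (r / 2) ^ n" for n
  proof (rule Cauchy_inequality)
    show "G holomorphic_on ball z (r / 2)" "continuous_on (cball z (r / 2)) G"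
      using G(1) r by (auto intro!: holomorphic_on_imp_continuous_on elim!: holomorphic_on_subset)
  qed (use r Gle in \<open>auto simp: norm_minus_commute\<close>)
  have G1: "norm (deriv G z) \<le> 4 * M / r"
    using Cauchy[of 1] by (simp add: divide_simps)
  have G2: "norm (deriv (deriv G) z) \<le> 16 * M / r\<^sup>2"
    using Cauchy[of 2] by (simp add: numeral_2_eq_2 divide_simps)
  have df: "(f has_field_derivative f w * deriv G w) (at w)" if w: "w \<in> ball z r" for w
  proof -
    have "(G has_field_derivative deriv G w) (at w)"
      using G(1) w by (meson holomorphic_derivI open_ball)
    then have "((\<lambda>w. f z * exp (G w)) has_field_derivative f z * (exp (G w) * deriv G w)) (at w)"
      by (auto intro!: derivative_eq_intros)
    then have "((\<lambda>w. f z * exp (G w)) has_field_derivative f w * deriv G w) (at w)"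
      by (simp only: G(3)[OF w] mult.assoc)
    then show ?thesis
      by (rule has_field_derivative_transform_within_open[OF _ open_ball w]) (simp add: G(3)[symmetric])
  qed
  have dfz: "deriv f w = f w * deriv G w" if "w \<in> ball z r" for w
    using df[OF that] by (rule DERIV_imp_deriv)
  then have "norm (deriv f z) = norm (deriv G z) * norm (f z)"
    using r by (simp add: norm_mult mult.commute)
  then show "norm (deriv f z) \<le> 4 * M / r * norm (f z)"
    using mult_right_mono[OF G1, of "norm (f z)"] by simp
  have zb: "z \<in> ball z r"
    using r by simp
  have "deriv G holomorphic_on ball z r"
    using G(1) by (intro holomorphic_deriv) auto
  then have "(deriv G has_field_derivative deriv (deriv G) z) (at z)"
    using zb by (meson holomorphic_derivI open_ball)
  then have "((\<lambda>w. f w * deriv G w) has_field_derivative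
      f z * deriv G z * deriv G z + deriv (deriv G) z * f z) (at z)"
    by (rule DERIV_mult[OF df[OF zb]])
  then have "(deriv f has_field_derivative
      f z * deriv G z * deriv G z + deriv (deriv G) z * f z) (at z)"
    by (rule has_field_derivative_transform_within_open[OF _ open_ball zb]) (simp add: dfz)
  then have "deriv (deriv f) z = (deriv (deriv G) z + deriv G z * deriv G z) * f z"
    by (simp add: DERIV_imp_deriv algebra_simps)
  moreover have "norm (deriv (deriv G) z + deriv G z * deriv G z) \<le> 16 * M / r\<^sup>2 + (4 * M / r)\<^sup>2"
  proof (rule order_trans[OF norm_triangle_ineq], rule add_mono[OF G2])
    show "norm (deriv G z * deriv G z) \<le> (4 * M / r)\<^sup>2"
      unfolding norm_mult power2_eq_square using G1 by (intro mult_mono) (auto intro: order_trans[OF norm_ge_zero])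
  qed
  ultimately show "norm (deriv (deriv f) z) \<le> (16 * M / r\<^sup>2 + (4 * M / r)\<^sup>2) * norm (f z)"
    by (simp add: norm_mult mult_right_mono)
qed

text \<open>Pigeonhole principle: of \<open>N + 1\<close> equally spaced points of the interval, one has none of the \<open>N\<close>
given points within half the spacing.\<close>

lemma point_far_from_finite_set:
  fixes a b :: real
  assumes "finite X" "card X \<le> N" "a < b"
  obtains t where "a < t" "t < b" "\<And>x. x \<in> X \<Longrightarrow> (b - a) / (2 * (real N + 1)) \<le> \<bar>t - x\<bar>"
proof (rule ccontr)
  assume no: "\<not> thesis"
  note found = that
  define \<delta> where "\<delta> = (b - a) / (real N + 1)"
  define p where "p k = a + \<delta> * (real k + 1/2)" for k :: nat
  have \<delta>: "\<delta> > 0" "\<delta> * (real N + 1) = b - a"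
    using assms(3) by (auto simp: \<delta>_def)
  have p: "a < p k" "p k < b" if "k \<le> N" for k
  proof -
    show "a < p k"
      using \<delta> by (simp add: p_def)
    have "\<delta> * (real k + 1/2) < \<delta> * (real N + 1)"
      using \<delta> that by (intro mult_strict_left_mono) auto
    then show "p k < b"
      using \<delta> by (simp add: p_def)
  qed
  have "\<exists>x\<in>X. \<bar>p k - x\<bar> < \<delta> / 2" if "k \<le> N" for k
  proof (rule ccontr)
    assume "\<not> ?thesis"
    then have "\<And>x. x \<in> X \<Longrightarrow> (b - a) / (2 * (real N + 1)) \<le> \<bar>p k - x\<bar>"
      by (force simp: \<delta>_def field_simps not_less)
    then show False
      using no found[of "p k"] p[OF that] by blast
  qed
  then obtain g where g: "\<And>k. k \<le> N \<Longrightarrow> g k \<in> X \<and> \<bar>p k - g k\<bar> < \<delta> / 2"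
    by metis
  have "inj_on g {..N}"
  proof (rule inj_onI)
    fix i j assume ij: "i \<in> {..N}" "j \<in> {..N}" "g i = g j"
    then have "\<bar>p i - g i\<bar> < \<delta> / 2" "\<bar>p j - g i\<bar> < \<delta> / 2"
      using g[of i] g[of j] by auto
    then have "\<bar>p i - p j\<bar> < \<delta>"
      by linarith
    also have "p i - p j = \<delta> * (real i - real j)"
      by (simp add: p_def algebra_simps)
    finally have "\<bar>real i - real j\<bar> < 1"
      using \<delta> by (simp add: abs_mult)
    then show "i = j" by linarith
  qed
  then have "card {..N} \<le> card X"
    using g assms(1) by (intro card_inj_on_le[of g]) auto
  then show False
    using assms(2) by simp
qed

text \<open>What remains of \<open>f\<close> after its zeros in a disc about \<open>p\<close> are divided out. On the circle of radius
\<open>3 S\<close> every factor of the polynomial is at least \<open>2 S\<close>, at \<open>p\<close> it is at most \<open>S\<close>; comparing the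
two by the maximum principle gains a factor \<open>2\<close> for each zero. This bounds their number (a crude
form of Jensen's formula) and shows \<open>\<bar>h / h(p)\<bar> \<le> exp M / \<bar>f(p)\<bar>\<close>, whence \<open>Borel_Caratheodory\<close>
yields the lower bound for \<open>h\<close>.\<close>

lemma zero_free_part_bounds:
  fixes f h :: "complex \<Rightarrow> complex"
  assumes h: "h holomorphic_on UNIV" and fp: "f p \<noteq> 0" and S: "S > 0"
    and le: "\<And>z. norm (z - p) = 3 * S \<Longrightarrow> norm (f z) \<le> exp M"
    and ws: "set ws \<subseteq> ball p S" and hnz: "\<And>z. z \<in> ball p S \<Longrightarrow> h z \<noteq> 0"
    and eq: "\<And>z. f z = h z * (\<Prod>w\<leftarrow>ws. z - w)"
  shows "real (length ws) * ln 2 \<le> M - ln (norm (f p))"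
    and "norm (f p) \<le> norm (h p) * S ^ length ws"
    and "norm (z - p) \<le> S / 2 \<Longrightarrow> norm (h p) \<le> norm (h z) * exp (2 * (M - ln (norm (f p))))"
proof -
  define N where "N = length ws"
  have wn: "norm (w - p) < S" if "w \<in> set ws" for w
    using ws that by (auto simp: dist_norm norm_minus_commute)
  have hle: "norm (h z) * (2 * S) ^ N \<le> exp M" if "norm (z - p) \<le> 3 * S" for z
  proof -
    have "norm (h z) \<le> exp M / (2 * S) ^ N"
    proof (rule max_modulus_cball[OF h _ that])
      fix z assume z: "norm (z - p) = 3 * S"
      have "(2 * S) ^ N \<le> norm (\<Prod>w\<leftarrow>ws. z - w)"
        unfolding N_def
      proof (rule norm_root_prod_ge)
        fix w assume "w \<in> set ws"
        then show "2 * S \<le> norm (z - w)"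
          using wn[of w] z norm_triangle_ineq2[of "z - p" "w - p"] by simp
      qed (use S in auto)
      then have "norm (h z) * (2 * S) ^ N \<le> norm (h z) * norm (\<Prod>w\<leftarrow>ws. z - w)"
        by (intro mult_left_mono) auto
      also have "\<dots> \<le> exp M"
        using le[OF z] by (simp add: eq norm_mult)
      finally show "norm (h z) \<le> exp M / (2 * S) ^ N"
        using S by (simp add: divide_simps)
    qed
    then show ?thesis
      using S by (simp add: divide_simps)
  qed
  show fh: "norm (f p) \<le> norm (h p) * S ^ length ws"
    unfolding eq norm_mult
  proof (intro mult_left_mono norm_root_prod_le)
    fix w assume "w \<in> set ws"
    then show "norm (p - w) \<le> S"
      using wn[of w] by (simp add: norm_minus_commute)
  qed auto
  have "norm (f p) * 2 ^ N \<le> (norm (h p) * S ^ N) * 2 ^ N"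
    using fh by (intro mult_right_mono) (auto simp: N_def)
  also have "\<dots> = norm (h p) * (2 * S) ^ N"
    by (simp add: power_mult_distrib)
  also have "\<dots> \<le> exp M"
    using hle[of p] S by simp
  finally have "norm (f p) * 2 ^ N \<le> exp M" .
  then have "ln (norm (f p) * 2 ^ N) \<le> ln (exp M)"
    using fp by (subst ln_le_cancel_iff) auto
  then show "real (length ws) * ln 2 \<le> M - ln (norm (f p))"
    using fp by (simp add: ln_mult ln_realpow N_def)
  assume z: "norm (z - p) \<le> S / 2"
  obtain H where H: "H holomorphic_on ball p S" "H p = 0"
      "\<And>z. z \<in> ball p S \<Longrightarrow> norm (h z) = norm (h p) * exp (Re (H z))"
    using holomorphic_normalized_log[OF h S hnz] by blast
  have hp: "norm (h p) > 0"
    using hnz[of p] S by simp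
  define M0 where "M0 = M - ln (norm (f p))"
  have ReH: "Re (H z) \<le> M0" if "z \<in> ball p S" for z
  proof -
    have "norm (f p) * exp (Re (H z)) \<le> (norm (h p) * S ^ N) * exp (Re (H z))"
      using fh by (intro mult_right_mono) (auto simp: N_def)
    also have "\<dots> = norm (h z) * S ^ N"
      using H(3)[OF that] by (simp add: mult_ac)
    also have "\<dots> \<le> norm (h z) * (2 * S) ^ N"
      using S by (intro mult_left_mono power_mono) auto
    also have "\<dots> \<le> exp M"
      using hle[of z] that S by (auto simp: dist_norm norm_minus_commute)
    finally have "exp (ln (norm (f p)) + Re (H z)) \<le> exp M"
      using fp by (simp add: exp_add)
    then show ?thesis
      by (simp add: M0_def)
  qed
  have "norm (H z) \<le> 2 * M0 * (S / 2) / (S - S / 2)"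
    using Borel_Caratheodory[OF H(1,2) ReH z] S by simp
  then have "- Re (H z) \<le> 2 * M0"
    using abs_Re_le_cmod[of "H z"] S by (simp add: field_simps)
  then have "norm (h p) * 1 \<le> norm (h p) * (exp (Re (H z)) * exp (2 * M0))"
    using hp by (intro mult_left_mono) (auto simp flip: exp_add)
  also have "\<dots> = norm (h z) * exp (2 * M0)"
  proof (subst H(3)[of z])
    have "norm (z - p) < S" using z S by linarith
    then show "z \<in> ball p S" by (simp add: dist_norm norm_minus_commute)
  qed simp
  finally show "norm (h p) \<le> norm (h z) * exp (2 * (M - ln (norm (f p))))"
    by (simp add: M0_def)
qed

text \<open>At a point \<open>z\<close> whose distance to the zeros of \<open>f\<close> is at least a negative power of \<open>R\<close>, the
factorization bounds \<open>log \<bar>f(z)\<bar>\<close> from below by minus a power of \<open>R\<close>, and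
\<open>log_derivative_bounds\<close> applies on a disc about \<open>z\<close> without zeros. As there are at most a power of
\<open>R\<close> zeros nearby, some circle about \<open>c\<close> keeps this distance from all of them.\<close>

lemma log_derivative_on_circles:
  fixes f :: "complex \<Rightarrow> complex"
  assumes f: "f holomorphic_on UNIV" and nz: "\<exists>z. f z \<noteq> 0"
    and growth: "\<And>z. norm z \<ge> r0 \<Longrightarrow> norm (f z) \<le> exp (norm z powr \<sigma>)"
    and \<sigma>: "\<sigma> > 0" and \<kappa>: "0 < \<kappa>" "\<kappa> \<le> 1"
  obtains C where "C > 0" "\<forall>\<^sub>F R in at_top. \<forall>c. norm c \<le> R \<longrightarrow>
    (\<exists>t. \<kappa> * R / 2 < t \<and> t < \<kappa> * R \<and> (\<forall>z. norm (z - c) = t \<longrightarrow> f z \<noteq> 0 \<and>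
       norm (deriv f z) \<le> R powr C * norm (f z) \<and>
       norm (deriv (deriv f) z) \<le> R powr C * norm (f z)))"
proof -
  obtain p where p: "f p \<noteq> 0" using nz by blast
  \<comment> \<open>With \<open>X = R powr (\<sigma> + 1)\<close>, the distance \<open>\<tau>\<close> to the zeros obtained below satisfies \<open>1 / \<tau> \<le> D X\<close>, and
    the quotients are at most \<open>12800 D\<^sup>4 X\<^sup>6\<close>; for large \<open>R\<close> the constant is absorbed into a seventh
    factor \<open>X\<close>.\<close>
  define D where "D = 13 / \<kappa>"
  have D: "D \<ge> 13"
    using \<kappa> by (simp add: D_def divide_simps)
  have ev: "\<forall>\<^sub>F R in at_top. (25 * R) powr \<sigma> - a \<le> R powr (\<sigma> + 1)"
    "\<forall>\<^sub>F R in at_top. b \<le> R powr (\<sigma> + 1)" for a b :: real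
    using \<sigma> by real_asymp+
  note ev1 = ev(1)[of "ln (norm (f p))"] and ev2 = ev(2)[of "12800 * D ^ 4"]
  have "\<forall>\<^sub>F R in at_top. \<forall>c. norm c \<le> R \<longrightarrow>
    (\<exists>t. \<kappa> * R / 2 < t \<and> t < \<kappa> * R \<and> (\<forall>z. norm (z - c) = t \<longrightarrow> f z \<noteq> 0 \<and>
       norm (deriv f z) \<le> R powr (7 * (\<sigma> + 1)) * norm (f z) \<and>
       norm (deriv (deriv f) z) \<le> R powr (7 * (\<sigma> + 1)) * norm (f z)))"
    using ev1 ev2 eventually_ge_at_top[of 1] eventually_ge_at_top[of "norm p"] eventually_ge_at_top[of r0]
  proof eventually_elim
    case (elim R)
    define M where "M = (25 * R) powr \<sigma>"
    define M0 where "M0 = M - ln (norm (f p))"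
    define X where "X = R powr (\<sigma> + 1)"
    have R: "R \<ge> 1" "R > 0" using elim by auto
    have X: "M0 \<le> X" "X \<ge> 12800 * D ^ 4" "X \<ge> 1" "X \<ge> R"
    proof -
      show "M0 \<le> X" "X \<ge> 12800 * D ^ 4"
        using elim by (auto simp: M0_def M_def X_def)
      have "R powr 1 \<le> X"
        unfolding X_def using R \<sigma> by (intro powr_mono) auto
      then show "X \<ge> R" "X \<ge> 1" using R by auto
    qed
    have fle: "norm (f z) \<le> exp M" if "norm z \<le> 25 * R" for z
    proof (rule max_modulus_cball[OF f, of 0 "25 * R"])
      fix z :: complex assume "norm (z - 0) = 25 * R"
      then show "norm (f z) \<le> exp M"
        using growth[of z] elim R by (simp add: M_def)
    qed (use that in auto)
    define S where "S = 8 * R"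
    obtain h ws where h: "h holomorphic_on UNIV" "\<And>z. z \<in> ball p S \<Longrightarrow> h z \<noteq> 0" "set ws \<subseteq> ball p S"
        "\<And>z. f z = h z * (\<Prod>w\<leftarrow>ws. z - w)"
      using entire_factor_zeros[OF f nz bounded_ball[of p S]] by metis
    define N where "N = length ws"
    have S: "S > 0" using R by (simp add: S_def)
    have le: "norm (f z) \<le> exp M" if "norm (z - p) = 3 * S" for z
    proof (rule fle)
      show "norm z \<le> 25 * R"
        using that elim norm_triangle_ineq[of "z - p" p] by (simp add: S_def)
    qed
    have count: "real N * ln 2 \<le> M0"
      unfolding N_def M0_def by (rule zero_free_part_bounds(1)[OF h(1) p S le h(3,2,4)]) assumption+
    have fp_le: "norm (f p) \<le> norm (h p) * S ^ N"
      unfolding N_def by (rule zero_free_part_bounds(2)[OF h(1) p S le h(3,2,4)]) assumption+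
    have hp_le: "norm (h p) \<le> norm (h z) * exp (2 * M0)" if "norm (z - p) \<le> S / 2" for z
      unfolding M0_def using that
      by (intro zero_free_part_bounds(3)[OF h(1) p S le h(3,2,4)]) assumption+
    have ln2: "ln 2 \<ge> (1/2 :: real)"
      using ln2_ge_two_thirds by linarith
    have "N * (1 / 2) \<le> N * ln 2"
      by (intro mult_left_mono ln2) auto
    then have N: "N \<le> 2 * M0" "0 \<le> M0"
      using count by auto
    show ?case
    proof (intro allI impI)
      fix c :: complex assume c: "norm c \<le> R"
      have "card ((\<lambda>w. norm (w - c)) ` set ws) \<le> N"
        unfolding N_def by (rule order_trans[OF card_image_le[OF finite_set] card_length])
      moreover have "\<kappa> * R / 2 < \<kappa> * R"
        using R \<kappa> by simp
      ultimately obtain t where t: "\<kappa> * R / 2 < t" "t < \<kappa> * R"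
        and far': "\<And>x. x \<in> (\<lambda>w. norm (w - c)) ` set ws \<Longrightarrow>
          (\<kappa> * R - \<kappa> * R / 2) / (2 * (real N + 1)) \<le> \<bar>t - x\<bar>"
        using point_far_from_finite_set[of "(\<lambda>w. norm (w - c)) ` set ws" N "\<kappa> * R / 2" "\<kappa> * R"]
        by blast
      have far: "\<kappa> * R / (4 * (real N + 1)) \<le> \<bar>t - norm (w - c)\<bar>" if "w \<in> set ws" for w
        using far'[of "norm (w - c)"] that by (simp add: field_simps)
      define \<tau> where "\<tau> = min 1 (\<kappa> * R / (4 * (real N + 1)))"
      have \<tau>: "0 < \<tau>" "\<tau> \<le> 1" "\<tau> \<le> \<kappa> * R / (4 * (real N + 1))"
        using R \<kappa> by (auto simp: \<tau>_def)
      have itau: "1 / \<tau> \<le> D * X"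
      proof -
        have "1 / \<tau> \<le> 1 + 4 * (real N + 1) / (\<kappa> * R)"
        proof -
          define y where "y = \<kappa> * R / (4 * (real N + 1))"
          have "y > 0" using R \<kappa> by (simp add: y_def)
          then have "1 / min 1 y \<le> 1 + 1 / y"
            by (auto simp: min_def)
          then show ?thesis by (simp add: \<tau>_def y_def)
        qed
        also have "4 * (real N + 1) / (\<kappa> * R) \<le> 4 * (2 * X + 1) / (\<kappa> * 1)"
          using R \<kappa> N X by (intro frac_le mult_left_mono) auto
        also have "1 + \<dots> \<le> X / \<kappa> + 4 * (2 * X + X) / \<kappa>"
        proof (rule add_mono)
          have "1 * \<kappa> \<le> X * 1" using X \<kappa> by (intro mult_mono) auto
          then show "1 \<le> X / \<kappa>" using \<kappa> by (simp add: field_simps)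
        qed (use X \<kappa> in \<open>auto simp: divide_simps\<close>)
        also have "\<dots> = D * X"
          by (simp add: D_def divide_simps)
        finally show ?thesis by simp
      qed
      show "\<exists>t. \<kappa> * R / 2 < t \<and> t < \<kappa> * R \<and> (\<forall>z. norm (z - c) = t \<longrightarrow> f z \<noteq> 0 \<and>
         norm (deriv f z) \<le> R powr (7 * (\<sigma> + 1)) * norm (f z) \<and>
         norm (deriv (deriv f) z) \<le> R powr (7 * (\<sigma> + 1)) * norm (f z))"
      proof (rule exI[of _ t], intro conjI t allI impI)
        fix z assume z: "norm (z - c) = t"
        have "t \<le> R"
          using t \<kappa> R mult_right_mono[of \<kappa> 1 R] by linarith
        then have nz2: "norm z \<le> 2 * R"
          using z c norm_triangle_ineq[of "z - c" c] by simp
        then have zp: "norm (z - p) \<le> 3 * R"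
          using elim norm_triangle_ineq4[of z p] by linarith
        have zw: "\<tau> \<le> norm (z - w)" if "w \<in> set ws" for w
        proof -
          have "\<kappa> * R / (4 * (real N + 1)) \<le> \<bar>t - norm (w - c)\<bar>"
            using far[OF that] .
          also have "\<dots> \<le> norm (z - w)"
            using norm_triangle_ineq3[of "z - c" "w - c"] z by simp
          finally show ?thesis using \<tau> by linarith
        qed
        have nonz: "f u \<noteq> 0" if "u \<in> ball z \<tau>" for u
        proof -
          have "norm (u - p) \<le> norm (u - z) + norm (z - p)"
            using norm_triangle_ineq[of "u - z" "z - p"] by simp
          then have "u \<in> ball p S"
            using that \<tau> zp R by (auto simp: S_def dist_norm norm_minus_commute)
          moreover have "u \<notin> set ws"
            using zw[of u] that by (auto simp: dist_norm)
          ultimately show ?thesis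
            using h by (simp add: root_prod_eq_0_iff)
        qed
        then show fz: "f z \<noteq> 0" using \<tau> by simp
        have "\<tau> ^ N \<le> norm (\<Prod>w\<leftarrow>ws. z - w)"
          unfolding N_def using zw \<tau> by (intro norm_root_prod_ge) simp_all
        then have "norm (h z) * \<tau> ^ N \<le> norm (f z)"
          by (auto simp: h(4) norm_mult intro!: mult_left_mono)
        then have "norm (h z) \<le> norm (f z) * (1 / \<tau>) ^ N"
          using \<tau> by (simp add: divide_simps)
        moreover have "norm (f p) \<le> norm (h z) * exp (2 * M0) * S ^ N"
        proof (rule order_trans[OF fp_le mult_right_mono[OF hp_le]])
          show "norm (z - p) \<le> S / 2"
            using zp R by (simp add: S_def)
        qed (use S in auto)
        moreover have "0 \<le> exp (2 * M0) * S ^ N"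
          using S by simp
        ultimately have "norm (f p) \<le> norm (f z) * (1 / \<tau>) ^ N * (exp (2 * M0) * S ^ N)"
          using mult_right_mono[of "norm (h z)" "norm (f z) * (1 / \<tau>) ^ N" "exp (2 * M0) * S ^ N"]
          unfolding mult.assoc by linarith
        also have "\<dots> = norm (f z) * exp (2 * M0 + N * ln (1 / \<tau>) + N * ln S)"
          using \<tau> S by (simp add: exp_add exp_of_nat_mult)
        finally have fpz: "norm (f p) \<le> norm (f z) * exp (2 * M0 + N * ln (1 / \<tau>) + N * ln S)" .
        define Q where "Q = 3 * M0 + N * ln (1 / \<tau>) + N * ln S"
        have ub: "norm (f u) \<le> exp Q * norm (f z)" if "u \<in> ball z \<tau>" for u
        proof -
          have "norm (u - z) < 1"
            using that \<tau> by (auto simp: dist_norm norm_minus_commute)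
          then have "norm (f u) \<le> exp M"
            using nz2 R norm_triangle_ineq[of "u - z" z] by (intro fle) auto
          also have "\<dots> = exp M0 * norm (f p)"
            using p by (simp add: M0_def exp_diff)
          also have "\<dots> \<le> exp M0 * (norm (f z) * exp (2 * M0 + N * ln (1 / \<tau>) + N * ln S))"
            using fpz by (intro mult_left_mono) auto
          also have "\<dots> = exp Q * norm (f z)"
            by (simp add: Q_def algebra_simps flip: exp_add)
          finally show ?thesis .
        qed
        have Q: "Q \<le> 20 * D * X\<^sup>2" "Q \<ge> 0"
        proof -
          have l1: "ln (1 / \<tau>) \<le> D * X" "0 \<le> ln (1 / \<tau>)"
            using itau ln_le_minus_one[of "1 / \<tau>"] \<tau> by (auto simp: ln_div ln_le_zero_iff)
          have l2: "ln S \<le> 8 * X" "0 \<le> ln S"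
            using ln_le_minus_one[of S] S X R by (auto simp: S_def)
          have N2: "real N \<le> 2 * X" "0 \<le> 2 * X"
            using N X by auto
          have "N * ln (1 / \<tau>) \<le> (2 * X) * (D * X)" "N * ln S \<le> (2 * X) * (8 * X)"
            by (rule mult_mono[OF N2(1) l1(1) N2(2) l1(2)], rule mult_mono[OF N2(1) l2(1) N2(2) l2(2)])
          moreover have "X \<le> X * X"
            using X mult_right_mono[of 1 X X] by simp
          then have "3 * M0 \<le> 3 * (X * X)"
            using X(1) by linarith
          ultimately have "Q \<le> (19 + 2 * D) * X\<^sup>2"
            by (simp add: Q_def power2_eq_square algebra_simps)
          also have "\<dots> \<le> (20 * D) * X\<^sup>2"
            using D by (intro mult_right_mono) auto
          finally show "Q \<le> 20 * D * X\<^sup>2" .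
          show "Q \<ge> 0"
            using l1 l2 N by (auto simp: Q_def intro!: add_nonneg_nonneg)
        qed
        have d1: "norm (deriv f z) \<le> 4 * Q / \<tau> * norm (f z)"
          by (rule log_derivative_bounds(1)[OF f \<tau>(1) nonz ub]) assumption+
        have d2: "norm (deriv (deriv f) z) \<le> (16 * Q / \<tau>\<^sup>2 + (4 * Q / \<tau>)\<^sup>2) * norm (f z)"
          by (rule log_derivative_bounds(2)[OF f \<tau>(1) nonz ub]) assumption+
        have Qt: "4 * Q / \<tau> \<le> 80 * D\<^sup>2 * X ^ 3"
        proof -
          have "4 * Q * (1 / \<tau>) \<le> 4 * (20 * D * X\<^sup>2) * (D * X)"
            using Q itau \<tau> by (intro mult_mono) auto
          then show ?thesis by (simp add: power2_eq_square power3_eq_cube mult_ac)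
        qed
        have X7: "6400 * D ^ 4 * X ^ 6 + 6400 * D ^ 4 * X ^ 6 \<le> R powr (7 * (\<sigma> + 1))"
        proof -
          have "6400 * D ^ 4 * X ^ 6 + 6400 * D ^ 4 * X ^ 6 = 12800 * D ^ 4 * X ^ 6"
            by simp
          also have "\<dots> \<le> X * X ^ 6"
            using X by (intro mult_right_mono) auto
          also have "\<dots> = X ^ 7"
            by (simp add: eval_nat_numeral)
          also have "\<dots> = X powr 7"
            using X by (simp add: powr_numeral)
          also have "\<dots> = R powr (7 * (\<sigma> + 1))"
            by (simp add: X_def powr_powr mult.commute)
          finally show ?thesis .
        qed
        have D1: "0 \<le> 6400 * D ^ 4 * X ^ 6"
          using D X by auto
        have "80 * D\<^sup>2 * X ^ 3 \<le> 6400 * D ^ 4 * X ^ 6"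
          using D X by (intro mult_mono power_increasing) auto
        then have "4 * Q / \<tau> \<le> R powr (7 * (\<sigma> + 1))"
          using Qt X7 D1 by linarith
        then show "norm (deriv f z) \<le> R powr (7 * (\<sigma> + 1)) * norm (f z)"
          by (intro order_trans[OF d1 mult_right_mono]) auto
        have "16 * Q / \<tau>\<^sup>2 \<le> 6400 * D ^ 4 * X ^ 6"
        proof -
          have "16 * Q / \<tau>\<^sup>2 = 16 * Q * (1 / \<tau>) * (1 / \<tau>)"
            by (simp add: power2_eq_square)
          also have "\<dots> \<le> 16 * (20 * D * X\<^sup>2) * (D * X) * (D * X)"
            using Q itau \<tau> D X by (intro mult_mono) auto
          also have "\<dots> = 320 * D ^ 3 * X ^ 4"
            by (simp add: eval_nat_numeral mult_ac)
          also have "\<dots> \<le> 6400 * D ^ 4 * X ^ 6"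
            using D X by (intro mult_mono power_increasing) auto
          finally show ?thesis .
        qed
        moreover have "(4 * Q / \<tau>)\<^sup>2 \<le> 6400 * D ^ 4 * X ^ 6"
        proof -
          have "(4 * Q / \<tau>)\<^sup>2 \<le> (80 * D\<^sup>2 * X ^ 3)\<^sup>2"
            using Qt Q \<tau> by (intro power_mono) auto
          then show ?thesis
            by (simp add: power_mult_distrib flip: power_mult)
        qed
        ultimately have "16 * Q / \<tau>\<^sup>2 + (4 * Q / \<tau>)\<^sup>2 \<le> R powr (7 * (\<sigma> + 1))"
          using X7 by linarith
        then show "norm (deriv (deriv f) z) \<le> R powr (7 * (\<sigma> + 1)) * norm (f z)"
          by (intro order_trans[OF d2 mult_right_mono]) auto
      qed
    qed
  qed
  then show ?thesis
    using that[of "7 * (\<sigma> + 1)"] \<sigma> by auto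
qed

section \<open>Order and growth in a direction\<close>

lemma order_less_imp_growth:
  fixes f :: "complex \<Rightarrow> complex"
  assumes f: "f holomorphic_on UNIV" and s: "entire_order f < ereal s"
  obtains r0 where "\<And>z. norm z \<ge> r0 \<Longrightarrow> norm (f z) \<le> exp (norm z powr s)"
proof -
  have "\<forall>\<^sub>F r in at_top. ereal (log_plus (log_plus (max_modulus r f)) / ln r) < ereal s"
    using s unfolding entire_order_def by (rule Limsup_lessD)
  then have "\<forall>\<^sub>F r in at_top. \<forall>z. norm z = r \<longrightarrow> norm (f z) \<le> exp (r powr s)"
    using eventually_gt_at_top[of 1]
  proof eventually_elim
    case (elim r)
    have less: "log_plus (log_plus (max_modulus r f)) < s * ln r"
      using elim by (simp add: divide_simps)
    have 1: "log_plus (max_modulus r f) \<le> r powr s"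
    proof (cases "log_plus (max_modulus r f) > 0")
      case True
      then have "ln (log_plus (max_modulus r f)) < s * ln r"
        using less by (simp add: log_plus_def)
      then have "ln (log_plus (max_modulus r f)) < ln (r powr s)"
        using elim by (simp add: ln_powr)
      then show ?thesis
        using True elim by (subst (asm) ln_less_cancel_iff) auto
    next
      case False
      then show ?thesis
        by (meson linorder_le_less_linear order_trans powr_ge_zero)
    qed
    have 2: "max_modulus r f \<le> exp (r powr s)"
    proof (cases "max_modulus r f > 0")
      case True
      have "ln (max_modulus r f) \<le> ln (exp (r powr s))"
        using 1 by (simp add: log_plus_def)
      then show ?thesis
        using True by (subst (asm) ln_le_cancel_iff) auto
    next
      case False
      then show ?thesis
        by (meson exp_ge_zero linorder_le_less_linear order_trans)
    qed
    have "continuous_on (sphere 0 r) f"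
      using f by (meson holomorphic_on_imp_continuous_on holomorphic_on_subset top_greatest)
    then have bdd: "bdd_above ((\<lambda>z. norm (f z)) ` sphere 0 r)"
      by (intro bounded_imp_bdd_above compact_imp_bounded compact_continuous_image continuous_intros) auto
    show ?case
    proof (intro allI impI)
      fix z :: complex assume "norm z = r"
      then have "norm (f z) \<le> max_modulus r f"
        unfolding max_modulus_def by (intro cSUP_upper[OF _ bdd]) auto
      then show "norm (f z) \<le> exp (r powr s)"
        using 2 by linarith
    qed
  qed
  then obtain r0 where "\<And>r. r \<ge> r0 \<Longrightarrow> \<forall>z. norm z = r \<longrightarrow> norm (f z) \<le> exp (r powr s)"
    by (auto simp: eventually_at_top_linorder)
  then show ?thesis
    using that by blast
qed

lemma growth_imp_order_le:
  fixes f :: "complex \<Rightarrow> complex"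
  assumes s: "s \<ge> 0" and ev: "\<forall>\<^sub>F r in at_top. \<forall>z. norm z = r \<longrightarrow> norm (f z) \<le> exp (r powr s)"
  shows "entire_order f \<le> ereal s"
  unfolding entire_order_def
proof (rule Limsup_bounded)
  show "\<forall>\<^sub>F r in at_top. ereal (log_plus (log_plus (max_modulus r f)) / ln r) \<le> ereal s"
    using ev eventually_gt_at_top[of 1]
  proof eventually_elim
    case (elim r)
    have "complex_of_real r \<in> sphere 0 r"
      using elim by simp
    then have ne: "sphere (0::complex) r \<noteq> {}"
      by blast
    have "max_modulus r f \<le> exp (r powr s)"
      unfolding max_modulus_def using elim by (intro cSUP_least[OF ne]) auto
    moreover have "0 \<le> max_modulus r f"
    proof -
      have "bdd_above ((\<lambda>z. norm (f z)) ` sphere 0 r)"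
        using elim by (intro bdd_aboveI2[of _ _ "exp (r powr s)"]) auto
      then have "norm (f (complex_of_real r)) \<le> max_modulus r f"
        unfolding max_modulus_def using elim by (intro cSUP_upper) auto
      then show ?thesis
        by (rule order_trans[OF norm_ge_zero])
    qed
    ultimately have "ln (max_modulus r f) \<le> r powr s"
      using ln_le_cancel_iff[of "max_modulus r f" "exp (r powr s)"] by (cases "max_modulus r f = 0") auto
    then have 1: "log_plus (max_modulus r f) \<le> r powr s"
      by (simp add: log_plus_def)
    have "log_plus (log_plus (max_modulus r f)) \<le> s * ln r"
    proof (cases "log_plus (max_modulus r f) > 0")
      case True
      then have "ln (log_plus (max_modulus r f)) \<le> ln (r powr s)"
        using 1 elim by (subst ln_le_cancel_iff) auto
      then show ?thesis
        using elim s by (simp add: log_plus_def[of "log_plus _"] ln_powr)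
    next
      case False
      then have "log_plus (max_modulus r f) = 0"
        by (simp add: log_plus_def)
      then show ?thesis
        using elim s by (simp add: log_plus_def[of 0])
    qed
    then show ?case
      using elim by (simp add: divide_simps)
  qed
qed

lemma finite_order_bound:
  assumes "entire_order f < \<infinity>"
  obtains k where "entire_order f < ereal k" "k > 0"
proof -
  obtain x where "entire_order f < ereal x"
    using ereal_dense2[OF assms] by blast
  then have "entire_order f < ereal (max x 1)"
    by (rule less_le_trans) simp
  then show thesis
    by (rule that) simp
qed

text \<open>The growth exponent stays below \<open>\<rho>\<close> uniformly near the ray, which makes slowness an open
condition on \<open>\<theta>\<close>.\<close>

definition slow_direction :: "(complex \<Rightarrow> complex) \<Rightarrow> real \<Rightarrow> real \<Rightarrow> bool" where
  "slow_direction f \<rho> \<theta> \<longleftrightarrow> (\<exists>\<delta>>0. \<exists>s. 0 < s \<and> s < \<rho> \<and>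
     (\<forall>\<^sub>F r in at_top. \<forall>\<phi>. \<bar>\<phi> - \<theta>\<bar> < \<delta> \<longrightarrow> norm (f (rcis r \<phi>)) \<le> exp (r powr s)))"

text \<open>The exponent may depend on the direction, but by compactness finitely many exponents suffice.\<close>

lemma order_less_if_all_directions_slow:
  fixes f :: "complex \<Rightarrow> complex"
  assumes slow: "\<And>\<theta>. slow_direction f \<rho> \<theta>"
  shows "entire_order f < ereal \<rho>"
proof -
  define Q where "Q a b \<longleftrightarrow> (\<exists>s. 0 < s \<and> s < \<rho> \<and>
     (\<forall>\<^sub>F r in at_top. \<forall>\<phi>. a \<le> \<phi> \<and> \<phi> \<le> b \<longrightarrow> norm (f (rcis r \<phi>)) \<le> exp (r powr s)))" for a b :: real
  have "- pi \<le> pi"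
    by simp
  then have "Q (- pi) pi"
  proof (induction rule: Bolzano)
    case (trans a b c)
    then obtain s t where s: "0 < s" "s < \<rho>"
        "\<forall>\<^sub>F r in at_top. \<forall>\<phi>. a \<le> \<phi> \<and> \<phi> \<le> b \<longrightarrow> norm (f (rcis r \<phi>)) \<le> exp (r powr s)"
      and t: "0 < t" "t < \<rho>"
        "\<forall>\<^sub>F r in at_top. \<forall>\<phi>. b \<le> \<phi> \<and> \<phi> \<le> c \<longrightarrow> norm (f (rcis r \<phi>)) \<le> exp (r powr t)"
      unfolding Q_def by blast
    have "\<forall>\<^sub>F r in at_top. \<forall>\<phi>. a \<le> \<phi> \<and> \<phi> \<le> c \<longrightarrow> norm (f (rcis r \<phi>)) \<le> exp (r powr (max s t))"
      using s(3) t(3) eventually_ge_at_top[of "1::real"]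
    proof eventually_elim
      case (elim r)
      have "exp (r powr s) \<le> exp (r powr (max s t))" "exp (r powr t) \<le> exp (r powr (max s t))"
        using elim by (auto intro!: powr_mono)
      then show ?case
        using elim by (meson linorder_le_cases order_trans)
    qed
    then show ?case
      unfolding Q_def using s t by (intro exI[of _ "max s t"]) auto
  next
    case (local x)
    obtain \<delta> s where \<delta>: "\<delta> > 0" and s: "0 < s" "s < \<rho>"
      "\<forall>\<^sub>F r in at_top. \<forall>\<phi>. \<bar>\<phi> - x\<bar> < \<delta> \<longrightarrow> norm (f (rcis r \<phi>)) \<le> exp (r powr s)"
      using slow[of x] unfolding slow_direction_def by blast
    have "Q a b" if "a \<le> x" "x \<le> b" "b - a < \<delta>" for a b
      unfolding Q_def
    proof (intro exI conjI)
      show "\<forall>\<^sub>F r in at_top. \<forall>\<phi>. a \<le> \<phi> \<and> \<phi> \<le> b \<longrightarrow> norm (f (rcis r \<phi>)) \<le> exp (r powr s)"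
        using s(3) by eventually_elim (use that in auto)
    qed (use s in auto)
    then show ?case
      using \<delta> by blast
  qed
  then obtain s where s: "0 < s" "s < \<rho>"
    "\<forall>\<^sub>F r in at_top. \<forall>\<phi>. - pi \<le> \<phi> \<and> \<phi> \<le> pi \<longrightarrow> norm (f (rcis r \<phi>)) \<le> exp (r powr s)"
    unfolding Q_def by blast
  have "entire_order f \<le> ereal s"
  proof (rule growth_imp_order_le)
    show "\<forall>\<^sub>F r in at_top. \<forall>z. norm z = r \<longrightarrow> norm (f z) \<le> exp (r powr s)"
      using s(3)
    proof eventually_elim
      case (elim r)
      show ?case
      proof (intro allI impI)
        fix z :: complex assume "norm z = r"
        then have "z = rcis r (Arg z)"
          using rcis_cmod_Arg[of z] by simp
        then show "norm (f z) \<le> exp (r powr s)"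
          using elim Arg_bounded[of z] by (metis less_eq_real_def)
      qed
    qed
  qed (use s in auto)
  then show ?thesis
    using s(2) by (meson ereal_less(3) less_ereal.simps(1) order_le_less_trans)
qed

section \<open>Directions that are not Borel directions\<close>

text \<open>The quotient of \<open>z\<close> and \<open>rcis R \<theta>\<close> is \<open>1 + w\<close> with \<open>\<bar>w\<bar> \<le> \<kappa>\<close>, and \<open>\<bar>Ln (1 + w)\<bar> \<le> 2 \<bar>w\<bar>\<close>.\<close>

lemma near_ray_rcis:
  assumes "norm (z - rcis R \<theta>) \<le> \<kappa> * R" "0 < \<kappa>" "\<kappa> < 1 / 2" "0 < R"
  obtains \<phi> where "z = rcis (norm z) \<phi>" "\<bar>\<phi> - \<theta>\<bar> \<le> 2 * \<kappa>" "R / 2 < norm z" "norm z < 2 * R"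
proof -
  define w where "w = z / rcis R \<theta> - 1"
  have R0: "rcis R \<theta> \<noteq> 0"
    using assms by simp
  have "w = (z - rcis R \<theta>) / rcis R \<theta>"
    using R0 by (simp add: w_def diff_divide_distrib)
  then have "norm w = norm (z - rcis R \<theta>) / R"
    using assms(4) by (simp only: norm_divide complex_mod_rcis abs_of_pos)
  also have "\<dots> \<le> \<kappa> * R / R"
    using assms by (intro divide_right_mono) auto
  finally have w: "norm w \<le> \<kappa>"
    using assms(4) by simp
  have z: "z = rcis R \<theta> * (1 + w)"
    using R0 by (simp add: w_def)
  have w1: "1 + w \<noteq> 0"
    using w assms norm_triangle_ineq2[of 1 "- w"] by auto
  have "\<bar>Arg (1 + w)\<bar> = \<bar>Im (Ln (1 + w))\<bar>"
    using w1 by (simp add: Arg_eq_Im_Ln)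
  also have "\<dots> \<le> norm (Ln (1 + w))"
    by (rule abs_Im_le_cmod)
  also have "\<dots> \<le> 2 * norm w"
    using w assms by (intro norm_Ln_le) auto
  finally have Arg: "\<bar>Arg (1 + w)\<bar> \<le> 2 * \<kappa>"
    using w by simp
  have "z = rcis R \<theta> * rcis (norm (1 + w)) (Arg (1 + w))"
    by (subst rcis_cmod_Arg) (rule z)
  then have z': "z = rcis (R * norm (1 + w)) (\<theta> + Arg (1 + w))"
    by (simp add: rcis_mult)
  have "1 - norm w \<le> norm (1 + w)" "norm (1 + w) \<le> 1 + norm w"
    using norm_triangle_ineq2[of 1 "- w"] norm_triangle_ineq[of 1 w] by auto
  then have n: "1 / 2 < norm (1 + w)" "norm (1 + w) < 2"
    using w assms by auto
  have nz: "norm z = R * norm (1 + w)"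
    using z' assms by (metis abs_of_nonneg less_eq_real_def mult_nonneg_nonneg norm_ge_zero complex_mod_rcis)
  show ?thesis
  proof (rule that[of "\<theta> + Arg (1 + w)"])
    show "z = rcis (norm z) (\<theta> + Arg (1 + w))"
      using z' nz by simp
    show "R / 2 < norm z" "norm z < 2 * R"
      using n assms(4) by (auto simp: nz)
  qed (use Arg in auto)
qed

lemma dist_rcis_le:
  assumes "R \<ge> 0"
  shows "norm (rcis R \<phi> - rcis R \<theta>) \<le> R * \<bar>\<phi> - \<theta>\<bar>"
proof -
  have "rcis R \<phi> - rcis R \<theta> = rcis R \<theta> * (cis (\<phi> - \<theta>) - 1)"
    by (simp add: rcis_def algebra_simps cis_mult flip: cis_divide)
  also have "norm \<dots> = R * (2 * \<bar>sin ((\<phi> - \<theta>) / 2)\<bar>)"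
    using assms dist_exp_i_1[of "\<phi> - \<theta>"] by (simp add: norm_mult cis_conv_exp)
  also have "\<dots> \<le> R * \<bar>\<phi> - \<theta>\<bar>"
    using assms abs_sin_x_le_abs_x[of "(\<phi> - \<theta>) / 2"] by (intro mult_left_mono) auto
  finally show ?thesis .
qed

lemma sector_subset_ball: "sector \<alpha> \<beta> r \<subseteq> ball 0 r"
  by (auto simp: sector_def)

lemma num_a_points_growth:
  fixes B :: "complex \<Rightarrow> complex"
  assumes B: "B holomorphic_on UNIV" and nc: "\<exists>z. B z \<noteq> a"
    and growth: "\<And>z. norm z \<ge> r0 \<Longrightarrow> norm (B z) \<le> exp (norm z powr s)"
    and s: "0 < s" "s < s'"
  shows "\<forall>\<^sub>F r in at_top. real (num_a_points B a (sector \<alpha> \<beta> r)) \<le> r powr s'"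
proof -
  obtain p where p: "B p \<noteq> a" using nc by blast
  have ev': "\<forall>\<^sub>F r in at_top. 2 * ((7 * r) powr s + x - y) \<le> r powr s'" for x y :: real
    using s by real_asymp
  note ev = ev'[of "norm a" "ln (norm (B p - a))"]
  show ?thesis
    using ev eventually_ge_at_top[of 1] eventually_ge_at_top[of "norm p"] eventually_ge_at_top[of r0]
  proof eventually_elim
    case (elim r)
    \<comment> \<open>The counting bound needs a centre at which \<open>B\<close> differs from \<open>a\<close>; the disc about \<open>p\<close> with twice the radius
      contains the one about the origin.\<close>
    define T where "T = ball p (2 * r)"
    have bT: "bounded T"
      by (simp add: T_def)
    obtain h ws where h: "h holomorphic_on UNIV" "\<And>z. z \<in> T \<Longrightarrow> h z \<noteq> 0" "set ws \<subseteq> T"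
      and len: "length ws = num_a_points B a T" and eq: "\<And>z. B z - a = h z * (\<Prod>w\<leftarrow>ws. z - w)"
      using entire_factor_a_points[OF B nc bT] by blast
    have count: "real (length ws) * ln 2 \<le> ((7 * r) powr s + norm a) - ln (norm (B p - a))"
    proof (rule zero_free_part_bounds(1)[OF h(1), where f = "\<lambda>z. B z - a" and p = p and S = "2 * r"])
      show "B p - a \<noteq> 0"
        using p by simp
      show "B z - a = h z * (\<Prod>w\<leftarrow>ws. z - w)" for z
        by (rule eq)
      fix z assume z: "norm (z - p) = 3 * (2 * r)"
      have z7: "norm z \<le> 7 * r" "norm z \<ge> 5 * r"
        using z elim norm_triangle_ineq[of "z - p" p] norm_triangle_ineq4[of z p] by auto
      then have "norm (B z) \<le> exp (norm z powr s)"
        using elim by (intro growth) auto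
      also have "\<dots> \<le> exp ((7 * r) powr s)"
        using z7 s by (simp add: powr_mono2)
      finally have "norm (B z - a) \<le> exp ((7 * r) powr s) + norm a"
        using norm_triangle_ineq4[of "B z" a] by linarith
      also have "\<dots> \<le> exp ((7 * r) powr s) * (1 + norm a)"
        by (simp add: distrib_left mult_le_cancel_right1 mult_right_mono[of 1 "exp ((7 * r) powr s)" "norm a", simplified])
      also have "\<dots> \<le> exp ((7 * r) powr s) * exp (norm a)"
        by (intro mult_left_mono exp_ge_add_one_self) auto
      finally show "norm (B z - a) \<le> exp ((7 * r) powr s + norm a)"
        by (simp add: exp_add)
    qed (use elim h in \<open>auto simp: T_def\<close>)
    have "real (length ws) = 2 * (real (length ws) * (1 / 2))"
      by simp
    also have "\<dots> \<le> 2 * (real (length ws) * ln 2)"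
      using ln2_ge_two_thirds by (intro mult_left_mono) auto
    also have "\<dots> \<le> 2 * ((7 * r) powr s + norm a - ln (norm (B p - a)))"
      using count by (intro mult_left_mono) auto
    also have "\<dots> \<le> r powr s'"
      by (rule elim(1))
    finally have "real (length ws) \<le> r powr s'" .
    moreover have "num_a_points B a (sector \<alpha> \<beta> r) \<le> num_a_points B a T"
    proof (rule num_a_points_mono[OF B nc])
      have "ball 0 r \<subseteq> T"
      proof
        fix z :: complex assume "z \<in> ball 0 r"
        then show "z \<in> T"
          unfolding T_def using elim norm_triangle_ineq4[of p z] by (simp add: dist_norm)
      qed
      then show "sector \<alpha> \<beta> r \<subseteq> T"
        using sector_subset_ball by blast
    qed (auto simp: T_def)
    ultimately show ?case
      using len by simp
  qed
qed

text \<open>The exceptional set of a Borel direction may have up to two elements, so trying first the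
empty set and then a singleton in its place produces two distinct values \<open>a\<close> for which the upper limit differs from
\<open>\<rho>\<close>. It cannot exceed \<open>\<rho>\<close> by \<open>num_a_points_growth\<close>.\<close>

lemma not_borel_direction_few_points:
  fixes B :: "complex \<Rightarrow> complex"
  assumes B: "B holomorphic_on UNIV" and \<rho>: "entire_order B = ereal \<rho>" "0 < \<rho>"
    and not_borel: "\<not> borel_direction B \<theta>"
  obtains \<epsilon> a1 a2 s where "0 < \<epsilon>" "a1 \<noteq> a2" "0 < s" "s < \<rho>" "\<exists>z. B z \<noteq> a1" "\<exists>z. B z \<noteq> a2"
    "\<forall>\<^sub>F r in at_top. real (num_a_points B a1 (sector (\<theta> - \<epsilon>) (\<theta> + \<epsilon>) r)) \<le> r powr s"
    "\<forall>\<^sub>F r in at_top. real (num_a_points B a2 (sector (\<theta> - \<epsilon>) (\<theta> + \<epsilon>) r)) \<le> r powr s"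
proof -
  have nonconst: "\<exists>z. B z \<noteq> a" for a
  proof (rule ccontr)
    assume "\<not> ?thesis"
    then have Ba: "B z = a" for z by auto
    have "\<forall>\<^sub>F r in at_top. x \<le> r powr (\<rho> / 2)" for x :: real
      using \<rho>(2) by real_asymp
    from this[of "ln (1 + norm a)"]
    have "\<forall>\<^sub>F r in at_top. \<forall>z. norm z = r \<longrightarrow> norm (B z) \<le> exp (r powr (\<rho> / 2))"
    proof eventually_elim
      case (elim r)
      have "norm a \<le> exp (ln (1 + norm a))"
        by (simp add: add_pos_nonneg)
      also have "\<dots> \<le> exp (r powr (\<rho> / 2))"
        using elim by simp
      finally show ?case
        by (simp add: Ba)
    qed
    then have "entire_order B \<le> ereal (\<rho> / 2)"
      using \<rho>(2) by (intro growth_imp_order_le) auto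
    then show False
      using \<rho> by simp
  qed
  obtain \<epsilon> where \<epsilon>: "\<epsilon> > 0" and neg: "\<forall>E. finite E \<and> card E \<le> 2 \<longrightarrow> (\<exists>a. a \<notin> E \<and>
     Limsup at_top (\<lambda>r::real. ereal (ln (real (num_a_points B a (sector (\<theta> - \<epsilon>) (\<theta> + \<epsilon>) r))) / ln r))
       \<noteq> entire_order B)"
    using not_borel unfolding borel_direction_def by meson
  have few: "\<exists>s. 0 < s \<and> s < \<rho> \<and>
      (\<forall>\<^sub>F r in at_top. real (num_a_points B a (sector (\<theta> - \<epsilon>) (\<theta> + \<epsilon>) r)) \<le> r powr s)"
    if ne: "Limsup at_top (\<lambda>r::real. ereal (ln (real (num_a_points B a (sector (\<theta> - \<epsilon>) (\<theta> + \<epsilon>) r))) / ln r))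
       \<noteq> entire_order B" for a
  proof -
    define n where "n r = real (num_a_points B a (sector (\<theta> - \<epsilon>) (\<theta> + \<epsilon>) r))" for r
    define l where "l = Limsup at_top (\<lambda>r::real. ereal (ln (n r) / ln r))"
    have "l \<le> ereal \<rho>"
    proof (rule ereal_le_epsilon2)
      fix e :: real assume e: "e > 0"
      have "entire_order B < ereal (\<rho> + e / 2)"
        using \<rho> e by simp
      then obtain r0 where "\<And>z. norm z \<ge> r0 \<Longrightarrow> norm (B z) \<le> exp (norm z powr (\<rho> + e / 2))"
        using order_less_imp_growth[OF B] by blast
      then have "\<forall>\<^sub>F r in at_top. n r \<le> r powr (\<rho> + e)"
        unfolding n_def by (rule num_a_points_growth[OF B nonconst, where s = "\<rho> + e / 2"]) (use \<rho>(2) e in auto)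
      then have "\<forall>\<^sub>F r in at_top. ereal (ln (n r) / ln r) \<le> ereal (\<rho> + e)"
        using eventually_gt_at_top[of 1]
      proof eventually_elim
        case (elim r)
        \<comment> \<open>If the value is not taken, \<open>ln 0 = 0\<close> makes the quotient zero.\<close>
        show ?case
        proof (cases "n r = 0")
          case True
          then show ?thesis using \<rho> e by simp
        next
          case False
          then have "n r > 0" by (simp add: n_def)
          then have "ln (n r) \<le> ln (r powr (\<rho> + e))"
            using elim by (subst ln_le_cancel_iff) auto
          then show ?thesis
            using elim by (simp add: ln_powr divide_simps)
        qed
      qed
      then show "l \<le> ereal \<rho> + ereal e"
        unfolding l_def by (simp add: Limsup_bounded)
    qed
    then have "l < ereal \<rho>"
      using ne \<rho>(1) by (simp add: l_def n_def order_less_le)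
    then obtain y where y: "l < ereal y" "y < \<rho>"
      using ereal_dense2 by force
    define s where "s = max y (\<rho> / 2)"
    have s: "0 < s" "s < \<rho>" "y \<le> s"
      using y \<rho>(2) by (auto simp: s_def)
    have "\<forall>\<^sub>F r in at_top. ereal (ln (n r) / ln r) < ereal y"
      using y(1) unfolding l_def by (rule Limsup_lessD)
    then have "\<forall>\<^sub>F r in at_top. n r \<le> r powr s"
      using eventually_gt_at_top[of 1]
    proof eventually_elim
      case (elim r)
      show ?case
      proof (cases "n r = 0")
        case False
        then have "n r > 0" by (simp add: n_def)
        have "ln (n r) \<le> y * ln r"
          using elim by (simp add: divide_simps)
        also have "\<dots> \<le> s * ln r"
          using s elim by (intro mult_right_mono) auto
        finally have "exp (ln (n r)) \<le> exp (s * ln r)"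
          by simp
        then show ?thesis
          using \<open>n r > 0\<close> elim by (simp add: powr_def)
      qed simp
    qed
    then show ?thesis
      using s unfolding n_def by blast
  qed
  obtain a1 where a1: "Limsup at_top (\<lambda>r::real. ereal (ln (real (num_a_points B a1 (sector (\<theta> - \<epsilon>) (\<theta> + \<epsilon>) r))) / ln r))
       \<noteq> entire_order B"
    using neg[rule_format, of "{}"] by auto
  obtain a2 where a2: "a2 \<noteq> a1" "Limsup at_top (\<lambda>r::real. ereal (ln (real (num_a_points B a2 (sector (\<theta> - \<epsilon>) (\<theta> + \<epsilon>) r))) / ln r))
       \<noteq> entire_order B"
    using neg[rule_format, of "{a1}"] by auto
  obtain s1 s2 where s1: "0 < s1" "s1 < \<rho>"
      "\<forall>\<^sub>F r in at_top. real (num_a_points B a1 (sector (\<theta> - \<epsilon>) (\<theta> + \<epsilon>) r)) \<le> r powr s1"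
    and s2: "0 < s2" "s2 < \<rho>"
      "\<forall>\<^sub>F r in at_top. real (num_a_points B a2 (sector (\<theta> - \<epsilon>) (\<theta> + \<epsilon>) r)) \<le> r powr s2"
    using few[OF a1] few[OF a2(2)] by blast
  show ?thesis
  proof (rule that[of \<epsilon> a1 a2 "max s1 s2"])
    show "\<forall>\<^sub>F r in at_top. real (num_a_points B a1 (sector (\<theta> - \<epsilon>) (\<theta> + \<epsilon>) r)) \<le> r powr max s1 s2"
      using s1(3) eventually_ge_at_top[of 1]
      by eventually_elim (rule order_trans, assumption, rule powr_mono, auto)
    show "\<forall>\<^sub>F r in at_top. real (num_a_points B a2 (sector (\<theta> - \<epsilon>) (\<theta> + \<epsilon>) r)) \<le> r powr max s1 s2"
      using s2(3) eventually_ge_at_top[of 1]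
      by eventually_elim (rule order_trans, assumption, rule powr_mono, auto)
  qed (use \<epsilon> a2 s1 s2 nonconst in auto)
qed

text \<open>Scaled to size \<open>R\<close>, \<open>small_near_one_of_two_values\<close> is applied about the point \<open>R exp(\<i> \<theta>0)\<close> with
\<open>m = R powr s'\<close> for some \<open>s' < \<rho>\<close> and \<open>L = R powr \<tau>\<close> with \<open>\<tau> > \<rho>\<close>. The interpolated exponent
\<open>t s' + (1 - t) \<tau>\<close> is less than \<open>\<rho>\<close> once \<open>\<tau>\<close> is close enough to \<open>\<rho>\<close>, which is possible because
\<open>t\<close> depends only on the radii.\<close>

lemma slow_direction_spreads:
  fixes B :: "complex \<Rightarrow> complex"
  assumes B: "B holomorphic_on UNIV" and \<rho>: "entire_order B = ereal \<rho>" "0 < \<rho>"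
    and \<epsilon>: "0 < \<epsilon>" "\<epsilon> \<le> 1" and a: "a1 \<noteq> a2" and nc: "\<exists>z. B z \<noteq> a1" "\<exists>z. B z \<noteq> a2"
    and s: "0 < s" "s < \<rho>"
    and few1: "\<forall>\<^sub>F r in at_top. real (num_a_points B a1 (sector (\<theta> - \<epsilon>) (\<theta> + \<epsilon>) r)) \<le> r powr s"
    and few2: "\<forall>\<^sub>F r in at_top. real (num_a_points B a2 (sector (\<theta> - \<epsilon>) (\<theta> + \<epsilon>) r)) \<le> r powr s"
    and slow: "slow_direction B \<rho> \<theta>0" and near: "\<bar>\<theta>0 - \<theta>\<bar> < \<epsilon> / 32"
  shows "slow_direction B \<rho> \<theta>"
proof -
  obtain \<delta> s1 where \<delta>: "\<delta> > 0" and s1: "0 < s1" "s1 < \<rho>"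
    and slow1: "\<forall>\<^sub>F r in at_top. \<forall>\<phi>. \<bar>\<phi> - \<theta>0\<bar> < \<delta> \<longrightarrow> norm (B (rcis r \<phi>)) \<le> exp (r powr s1)"
    using slow unfolding slow_direction_def by blast
  \<comment> \<open>The radii are in units of \<open>R\<close>, and a point within \<open>\<kappa> R\<close> of \<open>rcis R \<theta>0\<close> has an argument within
    \<open>2 \<kappa>\<close> of \<open>\<theta>0\<close>: the disc of radius \<open>r1\<close> stays where \<open>B\<close> is known to be slow, the one of radius
    \<open>\<epsilon> / 4\<close> in the sector of few zeros, and the one of radius \<open>\<epsilon> / 8\<close> reaches beyond the ray \<open>\<theta>\<close>.\<close>
  define r1 where "r1 = min (\<delta> / 4) (\<epsilon> / 16)"
  have r: "0 < r1" "r1 < \<epsilon> / 8" "\<epsilon> / 8 < \<epsilon> / 4" "\<epsilon> / 4 < 3 * \<epsilon> / 8" "2 * r1 < \<delta>" "r1 < 1 / 2"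
    using \<delta> \<epsilon> by (auto simp: r1_def)
  obtain t K where t: "0 < t" "t < 1" "0 < K" and local: "\<forall>B h1 h2 ws1 ws2 L m. B holomorphic_on UNIV \<longrightarrow>
       h1 holomorphic_on UNIV \<longrightarrow> h2 holomorphic_on UNIV \<longrightarrow> 1 \<le> m \<longrightarrow> m \<le> L \<longrightarrow>
       (\<forall>z. norm z \<le> r1 \<longrightarrow> norm (B z) \<le> exp m) \<longrightarrow> (\<forall>z. norm z \<le> 3 * \<epsilon> / 8 \<longrightarrow> norm (B z) \<le> exp L) \<longrightarrow>
       set ws1 \<subseteq> ball 0 (\<epsilon> / 4) \<longrightarrow> set ws2 \<subseteq> ball 0 (\<epsilon> / 4) \<longrightarrow> real (length ws1) \<le> m \<longrightarrow> real (length ws2) \<le> m \<longrightarrow>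
       (\<forall>z. norm z < \<epsilon> / 4 \<longrightarrow> h1 z \<noteq> 0) \<longrightarrow> (\<forall>z. norm z < \<epsilon> / 4 \<longrightarrow> h2 z \<noteq> 0) \<longrightarrow>
       (\<forall>z. B z - a1 = h1 z * (\<Prod>w\<leftarrow>ws1. z - w)) \<longrightarrow> (\<forall>z. B z - a2 = h2 z * (\<Prod>w\<leftarrow>ws2. z - w)) \<longrightarrow>
       (\<forall>z. norm z \<le> \<epsilon> / 8 \<longrightarrow> norm (B z) \<le> exp (K * m powr t * L powr (1 - t)))"
    using small_near_one_of_two_values[OF r(1,2,3,4) a] by blast
  define s' where "s' = (max s s1 + \<rho>) / 2"
  define \<tau> where "\<tau> = \<rho> + t * (\<rho> - s') / 2"
  define \<tau>' where "\<tau>' = (\<rho> + \<tau>) / 2"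
  define u where "u = t * s' + (1 - t) * \<tau>"
  have s': "s < s'" "s1 < s'" "s' < \<rho>" "0 < s'"
    using s s1 by (auto simp: s'_def)
  have \<tau>: "\<rho> < \<tau>'" "\<tau>' < \<tau>"
    using t s' by (auto simp: \<tau>'_def \<tau>_def)
  have u: "u < \<rho>" "0 < u"
  proof -
    have "u = \<rho> - t * (\<rho> - s') + (1 - t) * (t * (\<rho> - s') / 2)"
      by (simp add: u_def \<tau>_def algebra_simps)
    also have "\<dots> = \<rho> - (1 + t) * (t * (\<rho> - s') / 2)"
      by (simp add: field_simps)
    finally have "u = \<rho> - (1 + t) * (t * (\<rho> - s') / 2)" .
    moreover have "(1 + t) * (t * (\<rho> - s') / 2) > 0"
      using t s' by simp
    ultimately show "u < \<rho>" by linarith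
    show "0 < u"
      unfolding u_def using t s' \<tau> \<rho>(2) by (intro add_pos_pos mult_pos_pos) auto
  qed
  have "entire_order B < ereal \<tau>'"
    using \<rho> \<tau> by simp
  then obtain r0 where growth: "\<And>z. norm z \<ge> r0 \<Longrightarrow> norm (B z) \<le> exp (norm z powr \<tau>')"
    using order_less_imp_growth[OF B] by blast
  obtain q where slowq: "\<And>r \<phi>. r \<ge> q \<Longrightarrow> \<bar>\<phi> - \<theta>0\<bar> < \<delta> \<Longrightarrow> norm (B (rcis r \<phi>)) \<le> exp (r powr s1)"
    using slow1 unfolding eventually_at_top_linorder by blast
  obtain q1 where fewq1: "\<And>r. r \<ge> q1 \<Longrightarrow> real (num_a_points B a1 (sector (\<theta> - \<epsilon>) (\<theta> + \<epsilon>) r)) \<le> r powr s"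
    using few1 unfolding eventually_at_top_linorder by blast
  obtain q2 where fewq2: "\<And>r. r \<ge> q2 \<Longrightarrow> real (num_a_points B a2 (sector (\<theta> - \<epsilon>) (\<theta> + \<epsilon>) r)) \<le> r powr s"
    using few2 unfolding eventually_at_top_linorder by blast
  have ev: "\<forall>\<^sub>F R in at_top. (2 * R) powr s1 \<le> R powr s'" "\<forall>\<^sub>F R in at_top. (2 * R) powr s \<le> R powr s'"
    "\<forall>\<^sub>F R in at_top. (2 * R) powr \<tau>' \<le> R powr \<tau>" "\<forall>\<^sub>F R in at_top. K * R powr u \<le> R powr ((u + \<rho>) / 2)"
    using s' \<tau> u by (real_asymp, real_asymp, real_asymp, real_asymp)
  have "\<forall>\<^sub>F R in at_top. \<forall>\<phi>. \<bar>\<phi> - \<theta>\<bar> < \<epsilon> / 16 \<longrightarrow> norm (B (rcis R \<phi>)) \<le> exp (R powr ((u + \<rho>) / 2))"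
    using ev eventually_ge_at_top[of "1::real"] eventually_ge_at_top[of "2 * r0"] eventually_ge_at_top[of "2 * q"]
      eventually_ge_at_top[of q1] eventually_ge_at_top[of q2]
  proof eventually_elim
    case (elim R)
    define c where "c = rcis R \<theta>0"
    define T where "T = ball c (\<epsilon> / 4 * R)"
    define m where "m = R powr s'"
    define L where "L = R powr \<tau>"
    have R: "R > 0" "R \<ge> 1" "R \<noteq> 0"
      using elim by auto
    have m: "1 \<le> m" "m \<le> L"
      using R s' \<tau> by (auto simp: m_def L_def ge_one_powr_ge_zero intro!: powr_mono)
    have T_sector: "T \<subseteq> sector (\<theta> - \<epsilon>) (\<theta> + \<epsilon>) (2 * R)"
    proof
      fix z assume "z \<in> T"
      then have "norm (z - rcis R \<theta>0) \<le> \<epsilon> / 4 * R"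
        by (simp add: T_def c_def dist_norm norm_minus_commute)
      then obtain \<phi> where \<phi>: "z = rcis (norm z) \<phi>" "\<bar>\<phi> - \<theta>0\<bar> \<le> 2 * (\<epsilon> / 4)" "R / 2 < norm z" "norm z < 2 * R"
        using near_ray_rcis[of z R \<theta>0 "\<epsilon> / 4"] \<epsilon> R by auto
      then have "0 < norm z" "norm z < 2 * R" "\<theta> - \<epsilon> < \<phi>" "\<phi> < \<theta> + \<epsilon>"
        using R near \<epsilon> by linarith+
      then show "z \<in> sector (\<theta> - \<epsilon>) (\<theta> + \<epsilon>) (2 * R)"
        using \<phi>(1) unfolding sector_def by blast
    qed
    have factor: "\<exists>h ws. h holomorphic_on UNIV \<and> set ws \<subseteq> ball 0 (\<epsilon> / 4) \<and> real (length ws) \<le> m \<and>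
        (\<forall>z. norm z < \<epsilon> / 4 \<longrightarrow> h z \<noteq> 0) \<and> (\<forall>z::complex. B (c + R * z) - a = h z * (\<Prod>w\<leftarrow>ws. z - w))"
      if nc: "\<exists>z. B z \<noteq> a" and few: "real (num_a_points B a (sector (\<theta> - \<epsilon>) (\<theta> + \<epsilon>) (2 * R))) \<le> (2 * R) powr s" for a
    proof -
      have bT: "bounded T"
        by (simp add: T_def)
      obtain h ws where h: "h holomorphic_on UNIV" "\<And>z. z \<in> T \<Longrightarrow> h z \<noteq> 0" "set ws \<subseteq> T"
        and len: "length ws = num_a_points B a T" and eq: "\<And>z. B z - a = h z * (\<Prod>w\<leftarrow>ws. z - w)"
        using entire_factor_a_points[OF B nc bT] by blast
      have "length ws \<le> num_a_points B a (sector (\<theta> - \<epsilon>) (\<theta> + \<epsilon>) (2 * R))"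
        unfolding len using T_sector
        by (intro num_a_points_mono[OF B nc]) (auto intro: bounded_subset[OF bounded_ball sector_subset_ball])
      then have "real (length ws) \<le> m"
        using few elim by (simp add: m_def)
      moreover have "(\<lambda>z::complex. R ^ length ws * h (c + R * z)) holomorphic_on UNIV"
        by (intro holomorphic_intros holomorphic_on_compose_gen[OF _ h(1), unfolded o_def]) auto
      moreover have "complex_of_real R ^ length ws * h (c + R * z) \<noteq> 0" if "norm z < \<epsilon> / 4" for z :: complex
        using R h(2)[of "c + R * z"] that by (simp add: T_def dist_norm norm_mult)
      moreover have "set (map (\<lambda>w. (w - c) / R) ws) \<subseteq> ball 0 (\<epsilon> / 4)"
      proof
        fix z assume "z \<in> set (map (\<lambda>w. (w - c) / R) ws)"
        then obtain w where w: "w \<in> T" "z = (w - c) / R"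
          using h(3) by auto
        have "norm z = norm (w - c) / R"
          unfolding w(2) using R by (simp add: norm_divide)
        also have "\<dots> < \<epsilon> / 4"
          using w(1) R by (simp add: T_def dist_norm norm_minus_commute divide_simps mult_ac)
        finally show "z \<in> ball 0 (\<epsilon> / 4)"
          by simp
      qed
      moreover have "B (c + R * z) - a = (R ^ length ws * h (c + R * z)) * (\<Prod>w\<leftarrow>map (\<lambda>w. (w - c) / R) ws. z - w)" for z :: complex
        using eq[of "c + R * z"] root_prod_rescale[of "complex_of_real R" c z ws] R by (simp add: mult_ac)
      ultimately show ?thesis
        by (intro exI[of _ "\<lambda>z::complex. R ^ length ws * h (c + R * z)"] exI[of _ "map (\<lambda>w. (w - c) / R) ws"]) auto
    qed
    obtain h1 ws1 where h1: "h1 holomorphic_on UNIV" "set ws1 \<subseteq> ball 0 (\<epsilon> / 4)" "real (length ws1) \<le> m"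
        "\<forall>z. norm z < \<epsilon> / 4 \<longrightarrow> h1 z \<noteq> 0" "\<forall>z::complex. B (c + R * z) - a1 = h1 z * (\<Prod>w\<leftarrow>ws1. z - w)"
      using factor[OF nc(1) fewq1] elim by auto
    obtain h2 ws2 where h2: "h2 holomorphic_on UNIV" "set ws2 \<subseteq> ball 0 (\<epsilon> / 4)" "real (length ws2) \<le> m"
        "\<forall>z. norm z < \<epsilon> / 4 \<longrightarrow> h2 z \<noteq> 0" "\<forall>z::complex. B (c + R * z) - a2 = h2 z * (\<Prod>w\<leftarrow>ws2. z - w)"
      using factor[OF nc(2) fewq2] elim by auto
    have hol: "(\<lambda>z::complex. B (c + R * z)) holomorphic_on UNIV"
      by (intro holomorphic_intros holomorphic_on_compose_gen[OF _ B, unfolded o_def]) auto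
    have Bm: "norm (B (c + R * z)) \<le> exp m" if "norm z \<le> r1" for z :: complex
    proof -
      have "norm ((c + R * z) - rcis R \<theta>0) \<le> r1 * R"
        using that R by (simp add: c_def norm_mult)
      then obtain \<phi> where \<phi>: "c + R * z = rcis (norm (c + R * z)) \<phi>" "\<bar>\<phi> - \<theta>0\<bar> \<le> 2 * r1"
          "R / 2 < norm (c + R * z)" "norm (c + R * z) < 2 * R"
        using near_ray_rcis[of "c + R * z" R \<theta>0 r1] r R by auto
      define x where "x = norm (c + R * z)"
      have "norm (B (rcis x \<phi>)) \<le> exp (x powr s1)"
        using \<phi> elim r by (intro slowq) (auto simp: x_def)
      also have "x powr s1 \<le> (2 * R) powr s1"
        using \<phi> s1 by (intro powr_mono2) (auto simp: x_def)
      also have "\<dots> \<le> m"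
        using elim by (simp add: m_def)
      finally show ?thesis
        using \<phi>(1) by (simp add: x_def)
    qed
    have BL: "norm (B (c + R * z)) \<le> exp L" if "norm z \<le> 3 * \<epsilon> / 8" for z :: complex
    proof -
      have "norm ((c + R * z) - rcis R \<theta>0) \<le> (3 * \<epsilon> / 8) * R"
        using mult_left_mono[OF that, of R] R by (simp add: c_def norm_mult mult.commute)
      then have x: "R / 2 < norm (c + R * z)" "norm (c + R * z) < 2 * R"
        using near_ray_rcis[of "c + R * z" R \<theta>0 "3 * \<epsilon> / 8"] \<epsilon> R by auto
      then have "norm (B (c + R * z)) \<le> exp (norm (c + R * z) powr \<tau>')"
        using elim by (intro growth) auto
      also have "norm (c + R * z) powr \<tau>' \<le> (2 * R) powr \<tau>'"
        using x \<tau> \<rho>(2) by (intro powr_mono2) auto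
      also have "\<dots> \<le> L"
        using elim by (simp add: L_def)
      finally show ?thesis by simp
    qed
    have est: "norm (B (c + R * z)) \<le> exp (K * m powr t * L powr (1 - t))" if "norm z \<le> \<epsilon> / 8" for z :: complex
      by (rule local[rule_format, OF hol h1(1) h2(1) m Bm BL h1(2) h2(2) h1(3) h2(3)])
        (use h1(4,5) h2(4,5) that in auto)
    have mL: "K * m powr t * L powr (1 - t) \<le> R powr ((u + \<rho>) / 2)"
    proof -
      have "m powr t * L powr (1 - t) = R powr u"
        using R by (simp add: m_def L_def powr_powr u_def mult.commute flip: powr_add)
      then show ?thesis
        using elim by (simp add: mult.assoc)
    qed
    show ?case
    proof (intro allI impI)
      fix \<phi> assume \<phi>: "\<bar>\<phi> - \<theta>\<bar> < \<epsilon> / 16"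
      define z where "z = (rcis R \<phi> - c) / R"
      have "norm (rcis R \<phi> - c) \<le> R * \<bar>\<phi> - \<theta>0\<bar>"
        unfolding c_def using R by (intro dist_rcis_le) auto
      also have "\<dots> \<le> R * (\<epsilon> / 8)"
      proof (rule mult_left_mono)
        show "\<bar>\<phi> - \<theta>0\<bar> \<le> \<epsilon> / 8"
          using \<phi> near by linarith
      qed (use R in auto)
      finally have "norm z \<le> \<epsilon> / 8"
        using R by (simp add: z_def norm_divide divide_simps mult.commute)
      then have "norm (B (c + R * z)) \<le> exp (K * m powr t * L powr (1 - t))"
        by (rule est)
      also have "c + R * z = rcis R \<phi>"
        using R by (simp add: z_def)
      also have "exp (K * m powr t * L powr (1 - t)) \<le> exp (R powr ((u + \<rho>) / 2))"
        using mL by simp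
      finally show "norm (B (rcis R \<phi>)) \<le> exp (R powr ((u + \<rho>) / 2))" .
    qed
  qed
  then show ?thesis
    unfolding slow_direction_def using u \<epsilon>
    by (intro exI[of _ "\<epsilon> / 16"] exI[of _ "(u + \<rho>) / 2"] conjI) auto
qed

lemma slow_direction_if_not_borel:
  fixes B :: "complex \<Rightarrow> complex"
  assumes B: "B holomorphic_on UNIV" and \<rho>: "entire_order B = ereal \<rho>" "0 < \<rho>"
    and not_borel: "\<not> borel_direction B \<theta>"
    and near: "\<And>\<eta>. \<eta> > 0 \<Longrightarrow> \<exists>\<theta>'. \<bar>\<theta>' - \<theta>\<bar> < \<eta> \<and> slow_direction B \<rho> \<theta>'"
  shows "slow_direction B \<rho> \<theta>"
proof -
  obtain \<epsilon> a1 a2 s where \<epsilon>: "0 < \<epsilon>" and a: "a1 \<noteq> a2" and s: "0 < s" "s < \<rho>"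
    and nc: "\<exists>z. B z \<noteq> a1" "\<exists>z. B z \<noteq> a2"
    and few: "\<forall>\<^sub>F r in at_top. real (num_a_points B a1 (sector (\<theta> - \<epsilon>) (\<theta> + \<epsilon>) r)) \<le> r powr s"
    "\<forall>\<^sub>F r in at_top. real (num_a_points B a2 (sector (\<theta> - \<epsilon>) (\<theta> + \<epsilon>) r)) \<le> r powr s"
    by (rule not_borel_direction_few_points[OF B \<rho> not_borel])
  define \<epsilon>' where "\<epsilon>' = min \<epsilon> 1"
  have \<epsilon>': "0 < \<epsilon>'" "\<epsilon>' \<le> 1" "\<epsilon>' \<le> \<epsilon>"
    using \<epsilon> by (auto simp: \<epsilon>'_def)
  have few': "\<forall>\<^sub>F r in at_top. real (num_a_points B a (sector (\<theta> - \<epsilon>') (\<theta> + \<epsilon>') r)) \<le> r powr s"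
    if nc: "\<exists>z. B z \<noteq> a" and
      few: "\<forall>\<^sub>F r in at_top. real (num_a_points B a (sector (\<theta> - \<epsilon>) (\<theta> + \<epsilon>) r)) \<le> r powr s" for a
    using few
  proof eventually_elim
    case (elim r)
    have "num_a_points B a (sector (\<theta> - \<epsilon>') (\<theta> + \<epsilon>') r) \<le> num_a_points B a (sector (\<theta> - \<epsilon>) (\<theta> + \<epsilon>) r)"
    proof (rule num_a_points_mono[OF B nc])
      show "sector (\<theta> - \<epsilon>') (\<theta> + \<epsilon>') r \<subseteq> sector (\<theta> - \<epsilon>) (\<theta> + \<epsilon>) r"
      proof
        fix z assume "z \<in> sector (\<theta> - \<epsilon>') (\<theta> + \<epsilon>') r"
        then obtain t \<phi> where "z = rcis t \<phi>" "0 < t" "t < r" "\<theta> - \<epsilon>' < \<phi>" "\<phi> < \<theta> + \<epsilon>'"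
          unfolding sector_def by blast
        moreover have "\<theta> - \<epsilon> < \<phi>" "\<phi> < \<theta> + \<epsilon>"
          using calculation \<epsilon>'(3) by linarith+
        ultimately show "z \<in> sector (\<theta> - \<epsilon>) (\<theta> + \<epsilon>) r"
          unfolding sector_def by blast
      qed
      show "bounded (sector (\<theta> - \<epsilon>) (\<theta> + \<epsilon>) r)"
        by (rule bounded_subset[OF bounded_ball sector_subset_ball])
    qed
    then show ?case
      using elim by simp
  qed
  obtain \<theta>0 where "\<bar>\<theta>0 - \<theta>\<bar> < \<epsilon>' / 32" "slow_direction B \<rho> \<theta>0"
    using near[of "\<epsilon>' / 32"] \<epsilon>' by auto
  then show ?thesis
    using slow_direction_spreads[OF B \<rho> \<epsilon>'(1,2) a nc s few'[OF nc(1) few(1)] few'[OF nc(2) few(2)]] by blast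
qed

section \<open>The Phragmen-Lindeloef principle in a sector\<close>

text \<open>With \<open>w = z exp(- \<i> \<psi>)\<close>, in the coordinate \<open>\<zeta> = log w\<close> the sector becomes a half-strip and the
truncated sectors become rectangles, to which the maximum principle applies directly. Multiplying
\<open>B\<close> by \<open>exp(- K w powr s)\<close>, where \<open>K = 1 / cos (s \<beta>)\<close>, makes it bounded on the edges; the
additional factor \<open>exp(- e w powr \<tau>')\<close> beats the growth of \<open>B\<close> on the far side of a long rectangle,
and \<open>e\<close> tends to \<open>0\<close> at the end.\<close>

lemma Phragmen_Lindelof_sector:
  fixes B :: "complex \<Rightarrow> complex"
  assumes B: "B holomorphic_on UNIV" and \<beta>: "0 < \<beta>" and s: "0 < s" "s < \<tau>'" "\<tau> < \<tau>'" "\<tau>' * \<beta> < pi / 2"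
    and r0: "r0 > 0" and growth: "\<And>z. norm z \<ge> r0 \<Longrightarrow> norm (B z) \<le> exp (norm z powr \<tau>)"
    and edge1: "\<And>r. r \<ge> r0 \<Longrightarrow> norm (B (rcis r (\<psi> - \<beta>))) \<le> exp (r powr s)"
    and edge2: "\<And>r. r \<ge> r0 \<Longrightarrow> norm (B (rcis r (\<psi> + \<beta>))) \<le> exp (r powr s)"
    and r: "r \<ge> r0" and \<phi>: "\<bar>\<phi> - \<psi>\<bar> \<le> \<beta>"
  shows "norm (B (rcis r \<phi>)) \<le> exp (r0 powr \<tau> + r powr s / cos (s * \<beta>))"
proof -
  have sb: "s * \<beta> < pi / 2"
    using s \<beta> mult_strict_right_mono[of s \<tau>' \<beta>] by linarith
  define K where "K = 1 / cos (s * \<beta>)"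
  define c where "c = cos (\<tau>' * \<beta>)"
  have cs: "cos (s * \<beta>) > 0" and c: "c > 0"
    unfolding c_def using sb s \<beta> by (auto intro!: cos_gt_zero_pi simp: less_trans[of "- (pi / 2)" 0])
  have cos_ge: "cos (x * \<beta>) \<le> cos (x * y)" if "0 < x" "x * \<beta> < pi / 2" "\<bar>y\<bar> \<le> \<beta>" for x y
  proof -
    have "cos (x * \<beta>) \<le> cos \<bar>x * y\<bar>"
      using that pi_gt_zero by (intro cos_monotone_0_pi_le) (auto simp: abs_mult simp del: pi_gt_zero)
    then show ?thesis by simp
  qed
  have main: "norm (B (rcis r \<phi>)) \<le> exp (r0 powr \<tau>) * exp (K * r powr s + e * r powr \<tau>')" if e: "e > 0" for e
  proof -
    have "\<forall>\<^sub>F R in at_top. R powr \<tau> \<le> e * c * R powr \<tau>'"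
    proof -
      define d where "d = e * c"
      have "d > 0" using e c by (simp add: d_def)
      then have "\<forall>\<^sub>F R in at_top. R powr \<tau> \<le> d * R powr \<tau>'"
        using s(3) by real_asymp
      then show ?thesis by (simp add: d_def)
    qed
    then have "\<forall>\<^sub>F R in at_top. R powr \<tau> \<le> e * c * R powr \<tau>' \<and> R \<ge> r \<and> R \<ge> 1"
      by (intro eventually_conj eventually_ge_at_top)
    then obtain R where R: "R powr \<tau> \<le> e * c * R powr \<tau>'" "R \<ge> r" "R \<ge> 1"
      by (metis (no_types, lifting) eventually_at_top_linorder order_refl)
    define G where "G \<zeta> = B (cis \<psi> * exp \<zeta>) *
      exp (- (of_real K * exp (of_real s * \<zeta>)) - of_real e * exp (of_real \<tau>' * \<zeta>))" for \<zeta>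
    define D where "D = cbox (Complex (ln r0) (- \<beta>)) (Complex (ln R) \<beta>)"
    have G_hol: "G holomorphic_on S" for S
      unfolding G_def
      by (intro holomorphic_intros holomorphic_on_compose_gen[OF _ B, unfolded o_def]) auto
    have B_eq: "B (cis \<psi> * exp \<zeta>) = B (rcis (exp (Re \<zeta>)) (\<psi> + Im \<zeta>))" for \<zeta>
      by (simp add: exp_eq_polar rcis_def mult_ac flip: cis_mult)
    have G_norm: "norm (G \<zeta>) = norm (B (rcis (exp (Re \<zeta>)) (\<psi> + Im \<zeta>))) *
      exp (- (K * (exp (Re \<zeta>) powr s * cos (s * Im \<zeta>))) - e * (exp (Re \<zeta>) powr \<tau>' * cos (\<tau>' * Im \<zeta>)))" for \<zeta>
      by (simp add: G_def norm_mult B_eq Re_exp powr_def mult.commute)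
    have G_le: "norm (G \<zeta>) \<le> norm (B (rcis (exp (Re \<zeta>)) (\<psi> + Im \<zeta>))) *
        exp (- (exp (Re \<zeta>) powr s) - e * c * exp (Re \<zeta>) powr \<tau>')" if "\<bar>Im \<zeta>\<bar> \<le> \<beta>" for \<zeta>
    proof -
      have "exp (Re \<zeta>) powr s * 1 \<le> exp (Re \<zeta>) powr s * (K * cos (s * Im \<zeta>))"
        using cos_ge[of s "Im \<zeta>"] s sb that cs
        by (intro mult_left_mono) (auto simp: K_def divide_simps)
      then have "exp (Re \<zeta>) powr s \<le> K * (exp (Re \<zeta>) powr s * cos (s * Im \<zeta>))"
        by (simp add: mult_ac)
      moreover have "e * (exp (Re \<zeta>) powr \<tau>' * c) \<le> e * (exp (Re \<zeta>) powr \<tau>' * cos (\<tau>' * Im \<zeta>))"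
        using cos_ge[of \<tau>' "Im \<zeta>"] s that e by (intro mult_left_mono) (auto simp: c_def)
      then have "e * c * exp (Re \<zeta>) powr \<tau>' \<le> e * (exp (Re \<zeta>) powr \<tau>' * cos (\<tau>' * Im \<zeta>))"
        by (simp add: mult_ac)
      ultimately have "- (K * (exp (Re \<zeta>) powr s * cos (s * Im \<zeta>))) - e * (exp (Re \<zeta>) powr \<tau>' * cos (\<tau>' * Im \<zeta>))
          \<le> - (exp (Re \<zeta>) powr s) - e * c * exp (Re \<zeta>) powr \<tau>'"
        by linarith
      then show ?thesis
        unfolding G_norm by (intro mult_left_mono) auto
    qed
    have rR: "ln r0 \<le> ln r" "ln r \<le> ln R" "r > 0"
      using r r0 R by auto
    have frontier: "norm (G \<zeta>) \<le> exp (r0 powr \<tau>)" if "\<zeta> \<in> frontier D" for \<zeta>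
    proof -
      have "\<zeta> \<in> D - interior D"
        using that unfolding D_def frontier_def by simp
      then have in_D: "ln r0 \<le> Re \<zeta>" "Re \<zeta> \<le> ln R" "\<bar>Im \<zeta>\<bar> \<le> \<beta>"
        and edge: "Re \<zeta> = ln r0 \<or> Re \<zeta> = ln R \<or> Im \<zeta> = \<beta> \<or> Im \<zeta> = - \<beta>"
        unfolding D_def interior_cbox by (auto simp: in_cbox_complex_iff in_box_complex_iff)
      define x where "x = exp (Re \<zeta>)"
      have x: "r0 \<le> x" "x > 0"
      proof -
        have "exp (ln r0) \<le> x"
          using in_D(1) unfolding x_def by (simp only: exp_le_cancel_iff)
        then show "r0 \<le> x" "x > 0"
          using r0 by (simp_all add: x_def)
      qed
      define N where "N = norm (B (rcis x (\<psi> + Im \<zeta>)))"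
      have Nle: "norm (G \<zeta>) \<le> N * exp (- (x powr s) - e * c * x powr \<tau>')"
        using G_le[OF in_D(3)] by (simp add: x_def N_def)
      have "N \<le> exp (r0 powr \<tau> + (x powr s + e * c * x powr \<tau>'))"
      proof -
        have pos: "0 \<le> e * c * x powr \<tau>'" "0 \<le> x powr s" "0 \<le> r0 powr \<tau>"
          using e c by auto
        have gr: "N \<le> exp (x powr \<tau>)"
          using growth[of "rcis x (\<psi> + Im \<zeta>)"] x by (simp add: N_def)
        consider "Re \<zeta> = ln r0" | "Re \<zeta> = ln R" | "Im \<zeta> = \<beta>" | "Im \<zeta> = - \<beta>"
          using edge by blast
        then show ?thesis
        proof cases
          case 1
          then have "x = r0" using r0 by (simp add: x_def)
          then show ?thesis
            using gr pos by (smt (verit) exp_le_cancel_iff)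
        next
          case 2
          then have "x = R" using R by (simp add: x_def)
          then show ?thesis
            using gr pos R(1) by (smt (verit) exp_le_cancel_iff)
        next
          case 3
          then have "N \<le> exp (x powr s)"
            using edge2[of x] x by (simp add: N_def)
          then show ?thesis
            using pos by (smt (verit) exp_le_cancel_iff)
        next
          case 4
          then have "N \<le> exp (x powr s)"
            using edge1[of x] x by (simp add: N_def)
          then show ?thesis
            using pos by (smt (verit) exp_le_cancel_iff)
        qed
      qed
      then have "N * exp (- (x powr s) - e * c * x powr \<tau>') \<le>
          exp (r0 powr \<tau> + (x powr s + e * c * x powr \<tau>')) * exp (- (x powr s) - e * c * x powr \<tau>')"
        by (intro mult_right_mono) auto
      also have "\<dots> = exp (r0 powr \<tau>)"
        by (simp flip: exp_add)
      finally show ?thesis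
        using Nle by linarith
    qed
    \<comment> \<open>The point of the rectangle that corresponds to \<open>rcis r \<phi>\<close>.\<close>
    define \<zeta> where "\<zeta> = Complex (ln r) (\<phi> - \<psi>)"
    have "norm (G \<zeta>) \<le> exp (r0 powr \<tau>)"
    proof (rule maximum_modulus_frontier[OF _ _ _ frontier])
      show "continuous_on (closure D) G"
        using G_hol by (rule holomorphic_on_imp_continuous_on)
      show "\<zeta> \<in> D"
        using \<phi> rR by (auto simp: D_def \<zeta>_def in_cbox_complex_iff)
    qed (auto simp: D_def G_hol)
    then have G1: "norm (B (rcis r \<phi>)) *
        exp (- (K * (r powr s * cos (s * (\<phi> - \<psi>)))) - e * (r powr \<tau>' * cos (\<tau>' * (\<phi> - \<psi>)))) \<le> exp (r0 powr \<tau>)"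
      unfolding G_norm using rR by (simp add: \<zeta>_def)
    have "exp (- (K * (r powr s * 1)) - e * (r powr \<tau>' * 1)) \<le>
        exp (- (K * (r powr s * cos (s * (\<phi> - \<psi>)))) - e * (r powr \<tau>' * cos (\<tau>' * (\<phi> - \<psi>))))"
    proof -
      have "K * (r powr s * cos (s * (\<phi> - \<psi>))) \<le> K * (r powr s * 1)"
        using cs by (intro mult_left_mono) (auto simp: K_def)
      moreover have "e * (r powr \<tau>' * cos (\<tau>' * (\<phi> - \<psi>))) \<le> e * (r powr \<tau>' * 1)"
        using e by (intro mult_left_mono) auto
      ultimately show ?thesis
        by simp
    qed
    then have "norm (B (rcis r \<phi>)) * exp (- (K * (r powr s * 1)) - e * (r powr \<tau>' * 1)) \<le> exp (r0 powr \<tau>)"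
      using G1 by (meson mult_left_mono norm_ge_zero order_trans)
    then have "norm (B (rcis r \<phi>)) / exp (K * r powr s + e * r powr \<tau>') \<le> exp (r0 powr \<tau>)"
      by (simp add: exp_diff exp_minus exp_add divide_inverse mult_ac)
    then show ?thesis
      by (simp add: divide_simps)
  qed
  have "((\<lambda>e. exp (r0 powr \<tau>) * exp (K * r powr s + e * r powr \<tau>')) \<longlongrightarrow>
      exp (r0 powr \<tau>) * exp (K * r powr s + 0 * r powr \<tau>')) (at_right 0)"
    by (intro tendsto_intros)
  then have "norm (B (rcis r \<phi>)) \<le> exp (r0 powr \<tau>) * exp (K * r powr s + 0 * r powr \<tau>')"
    by (rule tendsto_lowerbound) (auto simp: main intro!: eventually_mono[OF eventually_at_right_less])
  then show ?thesis
    by (simp add: K_def exp_add)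
qed

text \<open>As the two edges may be moved inwards, the opening of the sector may be taken strictly less than
\<open>\<pi> / \<rho>\<close>, which leaves room for the exponents \<open>\<tau> < \<tau>'\<close> above \<open>\<rho>\<close> that
\<open>Phragmen_Lindelof_sector\<close> needs.\<close>

lemma slow_direction_between:
  fixes B :: "complex \<Rightarrow> complex"
  assumes B: "B holomorphic_on UNIV" and \<rho>: "entire_order B = ereal \<rho>" "0 < \<rho>"
    and slow: "slow_direction B \<rho> \<theta>1" "slow_direction B \<rho> \<theta>2"
    and between: "\<theta>1 < \<theta>" "\<theta> < \<theta>2" and gap: "\<rho> * (\<theta>2 - \<theta>1) \<le> pi"
  shows "slow_direction B \<rho> \<theta>"
proof -
  obtain \<delta>1 s1 where \<delta>1: "\<delta>1 > 0" and s1: "0 < s1" "s1 < \<rho>"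
    and slow1: "\<forall>\<^sub>F r in at_top. \<forall>\<phi>. \<bar>\<phi> - \<theta>1\<bar> < \<delta>1 \<longrightarrow> norm (B (rcis r \<phi>)) \<le> exp (r powr s1)"
    using slow(1) unfolding slow_direction_def by blast
  obtain \<delta>2 s2 where \<delta>2: "\<delta>2 > 0" and s2: "0 < s2" "s2 < \<rho>"
    and slow2: "\<forall>\<^sub>F r in at_top. \<forall>\<phi>. \<bar>\<phi> - \<theta>2\<bar> < \<delta>2 \<longrightarrow> norm (B (rcis r \<phi>)) \<le> exp (r powr s2)"
    using slow(2) unfolding slow_direction_def by blast
  define \<delta> where "\<delta> = min (min (\<delta>1 / 2) (\<delta>2 / 2)) (min ((\<theta> - \<theta>1) / 2) ((\<theta>2 - \<theta>) / 2))"
  have \<delta>: "\<delta> > 0" "\<delta> < \<delta>1" "\<delta> < \<delta>2" "\<delta> < \<theta> - \<theta>1" "\<delta> < \<theta>2 - \<theta>"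
    using \<delta>1 \<delta>2 between unfolding \<delta>_def min_def by auto
  define \<beta> where "\<beta> = (\<theta>2 - \<theta>1) / 2 - \<delta>"
  define \<psi> where "\<psi> = (\<theta>1 + \<theta>2) / 2"
  have \<beta>: "\<beta> > 0" "\<psi> - \<beta> = \<theta>1 + \<delta>" "\<psi> + \<beta> = \<theta>2 - \<delta>"
    using \<delta> by (auto simp: \<beta>_def \<psi>_def field_simps)
  have "\<rho> * \<beta> < pi / 2"
  proof -
    have "\<rho> * \<beta> = \<rho> * (\<theta>2 - \<theta>1) / 2 - \<rho> * \<delta>"
      by (simp add: \<beta>_def algebra_simps)
    moreover have "\<rho> * \<delta> > 0" using \<rho>(2) \<delta>(1) by simp
    ultimately show ?thesis using gap by linarith
  qed
  then have \<rho>\<beta>: "\<rho> < pi / (2 * \<beta>)"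
    using \<beta>(1) by (simp add: field_simps)
  obtain \<tau>' where \<tau>': "\<rho> < \<tau>'" and \<tau>'2: "\<tau>' < pi / (2 * \<beta>)"
    using dense[OF \<rho>\<beta>] by blast
  define \<tau> where "\<tau> = (\<rho> + \<tau>') / 2"
  have \<tau>: "\<rho> < \<tau>" "\<tau> < \<tau>'"
    using \<tau>' by (auto simp: \<tau>_def)
  have \<tau>\<beta>: "\<tau>' * \<beta> < pi / 2"
    using \<tau>'2 \<beta>(1) by (simp add: field_simps)
  define s where "s = max s1 s2"
  have s: "0 < s" "s < \<rho>"
    using s1 s2 by (auto simp: s_def)
  have "entire_order B < ereal \<tau>"
    using \<rho> \<tau> by simp
  then obtain q where growth: "\<And>z. norm z \<ge> q \<Longrightarrow> norm (B z) \<le> exp (norm z powr \<tau>)"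
    using order_less_imp_growth[OF B] by blast
  have "\<forall>\<^sub>F r in at_top. norm (B (rcis r (\<psi> - \<beta>))) \<le> exp (r powr s) \<and>
      norm (B (rcis r (\<psi> + \<beta>))) \<le> exp (r powr s) \<and> r \<ge> max 1 q"
    using slow1 slow2 eventually_ge_at_top[of "max 1 q"]
  proof eventually_elim
    case (elim r)
    have "norm (B (rcis r (\<psi> - \<beta>))) \<le> exp (r powr s1)" "norm (B (rcis r (\<psi> + \<beta>))) \<le> exp (r powr s2)"
      using elim \<delta> by (auto simp: \<beta>(2,3))
    moreover have "exp (r powr s1) \<le> exp (r powr s)" "exp (r powr s2) \<le> exp (r powr s)"
      using elim by (auto simp: s_def intro!: powr_mono)
    ultimately show ?case
      using elim(3) by (meson order_trans)
  qed
  then obtain r0 where r0: "\<And>r. r \<ge> r0 \<Longrightarrow> norm (B (rcis r (\<psi> - \<beta>))) \<le> exp (r powr s) \<and>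
      norm (B (rcis r (\<psi> + \<beta>))) \<le> exp (r powr s) \<and> r \<ge> max 1 q"
    unfolding eventually_at_top_linorder by blast
  have r01: "r0 \<ge> max 1 q"
    using r0[of r0] by simp
  have PL: "norm (B (rcis r \<phi>)) \<le> exp (r0 powr \<tau> + r powr s / cos (s * \<beta>))"
    if "r \<ge> r0" "\<bar>\<phi> - \<psi>\<bar> \<le> \<beta>" for r \<phi>
    by (rule Phragmen_Lindelof_sector[OF B \<beta>(1) s(1) _ \<tau>(2) \<tau>\<beta>, of r0 \<psi>])
      (use s \<tau> r01 r0 growth that in auto)
  define k where "k = 1 / cos (s * \<beta>)"
  have ev: "\<forall>\<^sub>F r in at_top. C + r powr s * k \<le> r powr ((s + \<rho>) / 2)" for C
    using s by real_asymp
  define \<eta> where "\<eta> = min (\<theta> - \<theta>1 - \<delta>) (\<theta>2 - \<delta> - \<theta>)"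
  have \<eta>: "\<eta> > 0"
    using \<delta> by (simp add: \<eta>_def)
  have "\<forall>\<^sub>F r in at_top. \<forall>\<phi>. \<bar>\<phi> - \<theta>\<bar> < \<eta> \<longrightarrow> norm (B (rcis r \<phi>)) \<le> exp (r powr ((s + \<rho>) / 2))"
    using ev[of "r0 powr \<tau>"] eventually_ge_at_top[of r0]
  proof eventually_elim
    case (elim r)
    show ?case
    proof (intro allI impI)
      fix \<phi> assume "\<bar>\<phi> - \<theta>\<bar> < \<eta>"
      then have "\<theta>1 + \<delta> \<le> \<phi>" "\<phi> \<le> \<theta>2 - \<delta>"
        by (auto simp: \<eta>_def)
      then have "\<bar>\<phi> - \<psi>\<bar> \<le> \<beta>"
        using \<beta>(2,3) by linarith
      then have "norm (B (rcis r \<phi>)) \<le> exp (r0 powr \<tau> + r powr s / cos (s * \<beta>))"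
        using elim by (intro PL) auto
      also have "\<dots> \<le> exp (r powr ((s + \<rho>) / 2))"
        using elim by (simp add: k_def)
      finally show "norm (B (rcis r \<phi>)) \<le> exp (r powr ((s + \<rho>) / 2))" .
    qed
  qed
  then show ?thesis
    unfolding slow_direction_def using \<eta> s
    by (intro exI[of _ \<eta>] exI[of _ "(s + \<rho>) / 2"] conjI) auto
qed

section \<open>Growth of \<open>v exp P\<close>\<close>

lemma poly_norm_le:
  fixes p :: "complex poly"
  assumes "degree p \<le> m"
  obtains C where "C \<ge> 0" "\<And>z. norm z \<ge> 1 \<Longrightarrow> norm (poly p z) \<le> C * norm z ^ m"
proof (rule that[of "\<Sum>i\<le>degree p. norm (coeff p i)"])
  fix z :: complex assume z: "norm z \<ge> 1"
  have "norm (poly p z) \<le> (\<Sum>i\<le>degree p. norm (coeff p i * z ^ i))"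
    unfolding poly_altdef by (rule norm_sum)
  also have "\<dots> \<le> (\<Sum>i\<le>degree p. norm (coeff p i) * norm z ^ m)"
    using z assms by (intro sum_mono) (auto simp: norm_mult norm_power intro!: mult_left_mono power_increasing)
  finally show "norm (poly p z) \<le> (\<Sum>i\<le>degree p. norm (coeff p i)) * norm z ^ m"
    by (simp add: sum_distrib_right)
qed (auto intro: sum_nonneg)

lemma exp_poly_times_growth:
  fixes v :: "complex \<Rightarrow> complex" and P :: "complex poly"
  assumes v: "\<And>z. norm z \<ge> q \<Longrightarrow> norm (v z) \<le> exp (norm z powr \<sigma>)"
  obtains C q' where "C \<ge> 0"
    "\<And>z. norm z \<ge> q' \<Longrightarrow> norm (v z * exp (poly P z)) \<le> exp (norm z powr \<sigma> + C * norm z powr degree P)"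
proof -
  obtain C where C: "C \<ge> 0" "\<And>z. norm z \<ge> 1 \<Longrightarrow> norm (poly P z) \<le> C * norm z ^ degree P"
    using poly_norm_le[of P "degree P"] by auto
  show ?thesis
  proof (rule that[OF C(1), of "max 1 q"])
    fix z :: complex assume z: "norm z \<ge> max 1 q"
    have "norm z powr degree P = norm z ^ degree P"
      using z by (intro powr_realpow) auto
    then have "Re (poly P z) \<le> C * norm z powr degree P"
      using C(2)[of z] z complex_Re_le_cmod[of "poly P z"] by auto
    then show "norm (v z * exp (poly P z)) \<le> exp (norm z powr \<sigma> + C * norm z powr degree P)"
      unfolding norm_mult exp_add using v[of z] z by (intro mult_mono) auto
  qed
qed

text \<open>On the ray \<open>\<theta>\<close>, and by continuity on the rays near it, the leading term of \<open>P\<close> has real part at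
most \<open>- c r\<^sup>n\<close>, and both the lower terms and \<open>log \<bar>v\<bar>\<close> are of smaller order.\<close>

lemma exp_poly_times_small:
  fixes v :: "complex \<Rightarrow> complex" and P :: "complex poly"
  assumes v: "\<And>z. norm z \<ge> q \<Longrightarrow> norm (v z) \<le> exp (norm z powr \<sigma>)"
    and \<sigma>: "\<sigma> < degree P" and n: "degree P > 0"
    and neg: "Re (lead_coeff P * exp (\<i> * of_nat (degree P) * of_real \<theta>)) < 0"
  shows "\<exists>\<delta>>0. \<forall>\<^sub>F r in at_top. \<forall>\<phi>. \<bar>\<phi> - \<theta>\<bar> \<le> \<delta> \<longrightarrow>
           norm (v (rcis r \<phi>) * exp (poly P (rcis r \<phi>))) \<le> 1"
proof -
  define n where "n = degree P"
  define g where "g \<phi> = Re (lead_coeff P * exp (\<i> * of_nat n * of_real \<phi>))" for \<phi>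
  define c where "c = - g \<theta> / 2"
  have c: "c > 0"
    using neg by (simp add: c_def g_def n_def)
  have "continuous_on UNIV g"
    unfolding g_def by (intro continuous_intros)
  then have "isCont g \<theta>"
    by (simp add: continuous_on_eq_continuous_at)
  then obtain d where d: "d > 0" "\<And>\<phi>. \<bar>\<phi> - \<theta>\<bar> < d \<Longrightarrow> \<bar>g \<phi> - g \<theta>\<bar> < c"
    using c unfolding continuous_at_eps_delta dist_real_def by blast
  have g_le: "g \<phi> \<le> - c" if "\<bar>\<phi> - \<theta>\<bar> \<le> d / 2" for \<phi>
    using d(1) d(2)[of \<phi>] that unfolding c_def by linarith
  define Q where "Q = P - monom (lead_coeff P) n"
  have "degree Q \<le> n - 1"
  proof -
    have "coeff Q n = 0"
      by (simp add: Q_def n_def)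
    moreover have "degree Q \<le> n"
      unfolding Q_def n_def by (intro degree_diff_le) (auto simp: degree_monom_le)
    ultimately show ?thesis
      using n unfolding n_def
      by (metis (no_types, lifting) One_nat_def Suc_pred degree_0 eq_zero_or_degree_less leD le_less_Suc_eq less_imp_le_nat n_def not_le zero_le)
  qed
  then obtain C where C: "C \<ge> 0" "\<And>z. norm z \<ge> 1 \<Longrightarrow> norm (poly Q z) \<le> C * norm z ^ (n - 1)"
    using poly_norm_le[of Q "n - 1"] by auto
  have P_eq: "poly P z = lead_coeff P * z ^ n + poly Q z" for z
    by (simp add: Q_def poly_monom)
  have asymp: "\<forall>\<^sub>F r in at_top. r powr \<sigma> + C * r powr x \<le> c * r powr y" if "x < y" "\<sigma> < y" for x y
  proof -
    define e where "e = c / 2"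
    have "e > 0" using c by (simp add: e_def)
    then have 1: "\<forall>\<^sub>F r in at_top. r powr \<sigma> \<le> e * r powr y" and 2: "\<forall>\<^sub>F r in at_top. C * r powr x \<le> e * r powr y"
      using that by (real_asymp, real_asymp)
    show ?thesis
      using 1 2 by eventually_elim (simp add: e_def)
  qed
  have "real (n - 1) < real n" using n by (simp add: n_def)
  then have ev: "\<forall>\<^sub>F r in at_top. r powr \<sigma> + C * r powr (real (n - 1)) \<le> c * r powr (real n)"
    using asymp[of "real (n - 1)" "real n"] \<sigma> by (simp add: n_def)
  have "\<forall>\<^sub>F r in at_top. \<forall>\<phi>. \<bar>\<phi> - \<theta>\<bar> \<le> d / 2 \<longrightarrow>
           norm (v (rcis r \<phi>) * exp (poly P (rcis r \<phi>))) \<le> 1"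
    using ev eventually_ge_at_top[of 1] eventually_ge_at_top[of q]
  proof eventually_elim
    case (elim r)
    show ?case
    proof (intro allI impI)
      fix \<phi> assume \<phi>: "\<bar>\<phi> - \<theta>\<bar> \<le> d / 2"
      define z where "z = rcis r \<phi>"
      have z: "norm z = r" using elim by (simp add: z_def)
      have Re_mult: "Re (complex_of_real x * w) = x * Re w" for x w
        by simp
      have e: "exp (\<i> * of_nat n * of_real \<phi>) = cis \<phi> ^ n"
        by (simp add: cis_conv_exp mult_ac flip: exp_of_nat_mult)
      have "lead_coeff P * z ^ n = complex_of_real (r ^ n) * (lead_coeff P * exp (\<i> * of_nat n * of_real \<phi>))"
        unfolding e by (simp add: z_def rcis_def power_mult_distrib mult_ac)
      then have "Re (lead_coeff P * z ^ n) = r ^ n * g \<phi>"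
        unfolding g_def by (simp only: Re_mult)
      also have "\<dots> \<le> r ^ n * (- c)"
        using g_le[OF \<phi>] elim by (intro mult_left_mono) auto
      finally have "Re (poly P z) \<le> - (c * r ^ n) + C * r ^ (n - 1)"
        using C(2)[of z] z elim complex_Re_le_cmod[of "poly Q z"] by (simp add: P_eq mult.commute)
      then have "r powr \<sigma> + Re (poly P z) \<le> 0"
        using elim by (simp add: powr_realpow)
      have "norm (v z * exp (poly P z)) \<le> exp (r powr \<sigma>) * exp (Re (poly P z))"
        unfolding norm_mult using v[of z] z elim by (intro mult_mono) auto
      also have "\<dots> = exp (r powr \<sigma> + Re (poly P z))"
        by (simp add: exp_add)
      also have "\<dots> \<le> 1"
        using \<open>r powr \<sigma> + Re (poly P z) \<le> 0\<close> by simp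
      finally show "norm (v (rcis r \<phi>) * exp (poly P (rcis r \<phi>))) \<le> 1"
        by (simp add: z_def)
    qed
  qed
  then show ?thesis
    using d(1) by (intro exI[of _ "d / 2"]) auto
qed

text \<open>If the order of \<open>v\<close> were at least the degree of \<open>P\<close>, then \<open>v exp P\<close> could not have a larger order
than \<open>v\<close>.\<close>

lemma entire_order_exp_factor_less:
  fixes A v :: "complex \<Rightarrow> complex" and P :: "complex poly"
  assumes v: "v holomorphic_on UNIV" and A: "\<And>z. A z = v z * exp (poly P z)"
    and less: "entire_order v < entire_order A" and n: "degree P > 0"
  shows "entire_order v < ereal (degree P)"
proof (rule ccontr)
  assume ge: "\<not> entire_order v < ereal (degree P)"
  obtain \<tau> where \<tau>: "entire_order v < ereal \<tau>" "ereal \<tau> < entire_order A"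
    using less ereal_dense2 by blast
  obtain \<sigma> where \<sigma>: "entire_order v < ereal \<sigma>" "ereal \<sigma> < ereal \<tau>"
    using \<tau>(1) ereal_dense2 by blast
  have "ereal (degree P) \<le> entire_order v"
    using ge by (simp add: not_less)
  then have "ereal (degree P) < ereal \<sigma>"
    using \<sigma>(1) by (rule le_less_trans)
  then have \<sigma>n: "real (degree P) < \<sigma>" "\<sigma> < \<tau>"
    using \<sigma>(2) by auto
  obtain q where "\<And>z. norm z \<ge> q \<Longrightarrow> norm (v z) \<le> exp (norm z powr \<sigma>)"
    using order_less_imp_growth[OF v \<sigma>(1)] by blast
  then obtain C q' where C: "C \<ge> 0"
    "\<And>z. norm z \<ge> q' \<Longrightarrow> norm (v z * exp (poly P z)) \<le> exp (norm z powr \<sigma> + C * norm z powr degree P)"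
    using exp_poly_times_growth by blast
  have "\<forall>\<^sub>F r in at_top. r powr \<sigma> + C * r powr y \<le> r powr \<tau>" if "y < \<tau>" for y
  proof -
    have 1: "\<forall>\<^sub>F r in at_top. 2 * r powr \<sigma> \<le> r powr \<tau>" and 2: "\<forall>\<^sub>F r in at_top. 2 * C * r powr y \<le> r powr \<tau>"
      using that \<sigma>n by (real_asymp, real_asymp)
    show ?thesis
      using 1 2 by eventually_elim simp
  qed
  from this[of "real (degree P)"]
  have "\<forall>\<^sub>F r in at_top. r powr \<sigma> + C * r powr degree P \<le> r powr \<tau>"
    using \<sigma>n by simp
  then have "\<forall>\<^sub>F r in at_top. \<forall>z. norm z = r \<longrightarrow> norm (A z) \<le> exp (r powr \<tau>)"
    using eventually_ge_at_top[of q']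
  proof eventually_elim
    case (elim r)
    show ?case
    proof (intro allI impI)
      fix z :: complex assume "norm z = r"
      then have "norm (A z) \<le> exp (r powr \<sigma> + C * r powr degree P)"
        using C(2)[of z] elim by (simp add: A)
      also have "\<dots> \<le> exp (r powr \<tau>)"
        using elim by simp
      finally show "norm (A z) \<le> exp (r powr \<tau>)" .
    qed
  qed
  then have "entire_order A \<le> ereal \<tau>"
    using \<sigma>n by (intro growth_imp_order_le) auto
  then show False
    using \<tau>(2) by simp
qed

section \<open>The differential equation\<close>

lemma ode_coefficient_le:
  fixes a b f0 f1 f2 :: complex
  assumes ode: "f2 + a * f1 + b * f0 = 0" and nz: "f0 \<noteq> 0"
    and le: "norm f1 \<le> X * norm f0" "norm f2 \<le> X * norm f0" and a: "norm a \<le> Y"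
  shows "norm b \<le> X * (1 + Y)"
proof -
  have "b * f0 = - (f2 + a * f1)"
    using ode by (simp add: add_eq_0_iff)
  then have "norm b * norm f0 = norm (f2 + a * f1)"
    by (metis norm_minus_cancel norm_mult)
  also have "\<dots> \<le> norm f2 + norm a * norm f1"
    using norm_triangle_ineq[of f2 "a * f1"] by (simp add: norm_mult)
  also have "\<dots> \<le> X * norm f0 + Y * (X * norm f0)"
    using le a by (intro add_mono mult_mono) (auto intro: order_trans[OF norm_ge_zero])
  also have "\<dots> = X * (1 + Y) * norm f0"
    by (simp add: algebra_simps)
  finally show ?thesis
    using nz by simp
qed

text \<open>On a circle about the origin that avoids the zeros of \<open>f\<close>, \<open>B = - f''/f - A f'/f\<close> is at most a
power of \<open>R\<close> times \<open>1 + \<bar>A\<bar>\<close>.\<close>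

lemma order_of_zero_order_coefficient_le:
  fixes f A B :: "complex \<Rightarrow> complex"
  assumes B: "B holomorphic_on UNIV" and f: "f holomorphic_on UNIV" and nz: "\<exists>z. f z \<noteq> 0"
    and finite: "entire_order f < \<infinity>"
    and ode: "\<And>z. deriv (deriv f) z + A z * deriv f z + B z * f z = 0"
    and A: "\<And>z. norm z \<ge> q \<Longrightarrow> norm (A z) \<le> exp (norm z powr \<sigma> + C * norm z powr n)"
    and C: "C \<ge> 0" and \<sigma>: "0 \<le> \<sigma>" "\<sigma> \<le> n"
  shows "entire_order B \<le> ereal n"
proof (rule ereal_le_epsilon2)
  fix e :: real assume e: "e > 0"
  obtain k where k: "entire_order f < ereal k" "k > 0"
    using finite by (rule finite_order_bound)
  obtain r0 where growth: "\<And>z. norm z \<ge> r0 \<Longrightarrow> norm (f z) \<le> exp (norm z powr k)"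
    using order_less_imp_growth[OF f k(1)] by blast
  obtain D where D: "D > 0" "\<forall>\<^sub>F R in at_top. \<forall>c. norm c \<le> R \<longrightarrow>
    (\<exists>t. 1 * R / 2 < t \<and> t < 1 * R \<and> (\<forall>z. norm (z - c) = t \<longrightarrow> f z \<noteq> 0 \<and>
       norm (deriv f z) \<le> R powr D * norm (f z) \<and>
       norm (deriv (deriv f) z) \<le> R powr D * norm (f z)))"
    by (rule log_derivative_on_circles[OF f nz growth k(2) zero_less_one order_refl])
  have asymp: "\<forall>\<^sub>F R in at_top. R powr D * 2 * exp (R powr \<sigma> + C * R powr n) \<le> exp ((R / 2) powr (n + e))"
  proof -
    have "\<forall>\<^sub>F R in at_top. ln (2 * R powr D) \<le> (R / 2) powr (n + e) / 3"
      "\<forall>\<^sub>F R in at_top. R powr \<sigma> \<le> (R / 2) powr (n + e) / 3"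
      "\<forall>\<^sub>F R in at_top. C * R powr n \<le> (R / 2) powr (n + e) / 3"
      using e \<sigma> D(1) by (real_asymp, real_asymp, real_asymp)
    then show ?thesis
      using eventually_gt_at_top[of 0]
    proof eventually_elim
      case (elim R)
      have "R powr D * 2 * exp (R powr \<sigma> + C * R powr n) = exp (ln (2 * R powr D) + (R powr \<sigma> + C * R powr n))"
        using elim by (simp add: exp_add mult_ac)
      also have "\<dots> \<le> exp ((R / 2) powr (n + e))"
        unfolding exp_le_cancel_iff using elim by linarith
      finally show ?case .
    qed
  qed
  \<comment> \<open>The good circle has an unknown radius between \<open>R / 2\<close> and \<open>R\<close>; by the maximum principle it controls the
    circle of radius \<open>R / 2\<close>.\<close>
  have "\<forall>\<^sub>F R in at_top. \<forall>z. norm z = R / 2 \<longrightarrow> norm (B z) \<le> exp ((R / 2) powr (n + e))"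
    using D(2) asymp eventually_ge_at_top[of 1] eventually_ge_at_top[of "2 * q"]
  proof eventually_elim
    case (elim R)
    obtain t where t: "R / 2 < t" "t < R" and der: "\<And>z. norm z = t \<Longrightarrow> f z \<noteq> 0 \<and>
       norm (deriv f z) \<le> R powr D * norm (f z) \<and>
       norm (deriv (deriv f) z) \<le> R powr D * norm (f z)"
      using elim(1)[rule_format, of 0] elim(3) by auto
    show ?case
    proof (intro allI impI)
      fix z :: complex assume z: "norm z = R / 2"
      show "norm (B z) \<le> exp ((R / 2) powr (n + e))"
      proof (rule max_modulus_cball[OF B, of 0 t])
        fix z :: complex assume z: "norm (z - 0) = t"
        define Y where "Y = exp (R powr \<sigma> + C * R powr n)"
        have "norm (A z) \<le> exp (t powr \<sigma> + C * t powr n)"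
          using A[of z] z t elim by auto
        also have "\<dots> \<le> Y"
          unfolding Y_def exp_le_cancel_iff using t elim \<sigma> C
          by (intro add_mono mult_left_mono powr_mono2) auto
        finally have "norm (B z) \<le> R powr D * (1 + Y)"
          using der[of z] z by (intro ode_coefficient_le[OF ode]) auto
        also have "\<dots> \<le> R powr D * (2 * Y)"
        proof (intro mult_left_mono)
          show "1 + Y \<le> 2 * Y"
            using C by (simp add: Y_def)
        qed auto
        also have "\<dots> \<le> exp ((R / 2) powr (n + e))"
          using elim by (simp add: Y_def mult_ac)
        finally show "norm (B z) \<le> exp ((R / 2) powr (n + e))" .
      qed (use z t in auto)
    qed
  qed
  then obtain R0 where R0: "\<And>R. R \<ge> R0 \<Longrightarrow> \<forall>z. norm z = R / 2 \<longrightarrow> norm (B z) \<le> exp ((R / 2) powr (n + e))"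
    unfolding eventually_at_top_linorder by blast
  have "\<forall>\<^sub>F r in at_top. \<forall>z. norm z = r \<longrightarrow> norm (B z) \<le> exp (r powr (n + e))"
    using eventually_ge_at_top[of "R0 / 2"]
  proof eventually_elim
    case (elim r)
    then show ?case
      using R0[of "2 * r"] by simp
  qed
  then have "entire_order B \<le> ereal (n + e)"
    using \<sigma> e by (intro growth_imp_order_le) auto
  then show "entire_order B \<le> ereal n + ereal e"
    by simp
qed

text \<open>The same estimate on a circle about a point of the ray, inside the sector where \<open>A\<close> is bounded by
\<open>1\<close>, leaves only a power of \<open>R\<close>; the maximum principle fills the circle.\<close>

lemma slow_direction_of_small_coefficient:
  fixes f A B :: "complex \<Rightarrow> complex"
  assumes B: "B holomorphic_on UNIV" and f: "f holomorphic_on UNIV" and nz: "\<exists>z. f z \<noteq> 0"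
    and finite: "entire_order f < \<infinity>"
    and ode: "\<And>z. deriv (deriv f) z + A z * deriv f z + B z * f z = 0"
    and \<delta>: "\<delta> > 0" and small: "\<forall>\<^sub>F r in at_top. \<forall>\<phi>. \<bar>\<phi> - \<theta>\<bar> \<le> \<delta> \<longrightarrow> norm (A (rcis r \<phi>)) \<le> 1"
    and \<rho>: "\<rho> > 0"
  shows "slow_direction B \<rho> \<theta>"
proof -
  obtain k where k: "entire_order f < ereal k" "k > 0"
    using finite by (rule finite_order_bound)
  obtain r0 where growth: "\<And>z. norm z \<ge> r0 \<Longrightarrow> norm (f z) \<le> exp (norm z powr k)"
    using order_less_imp_growth[OF f k(1)] by blast
  define \<kappa> where "\<kappa> = min (\<delta> / 2) (1 / 4)"
  have \<kappa>: "0 < \<kappa>" "\<kappa> \<le> 1" "2 * \<kappa> \<le> \<delta>" "\<kappa> < 1 / 2"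
    using \<delta> by (auto simp: \<kappa>_def)
  obtain D where D: "D > 0" "\<forall>\<^sub>F R in at_top. \<forall>c. norm c \<le> R \<longrightarrow>
    (\<exists>t. \<kappa> * R / 2 < t \<and> t < \<kappa> * R \<and> (\<forall>z. norm (z - c) = t \<longrightarrow> f z \<noteq> 0 \<and>
       norm (deriv f z) \<le> R powr D * norm (f z) \<and>
       norm (deriv (deriv f) z) \<le> R powr D * norm (f z)))"
    by (rule log_derivative_on_circles[OF f nz growth k(2) \<kappa>(1,2)])
  obtain q where small': "\<And>r \<phi>. r \<ge> q \<Longrightarrow> \<bar>\<phi> - \<theta>\<bar> \<le> \<delta> \<Longrightarrow> norm (A (rcis r \<phi>)) \<le> 1"
    using small unfolding eventually_at_top_linorder by blast
  have asymp: "\<forall>\<^sub>F R in at_top. R powr D * 2 \<le> exp (R powr (\<rho> / 2))"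
  proof -
    have "\<forall>\<^sub>F R in at_top. ln (2 * R powr D) \<le> R powr (\<rho> / 2)"
      using \<rho> D(1) by real_asymp
    then show ?thesis
      using eventually_gt_at_top[of 0]
    proof eventually_elim
      case (elim R)
      have "R powr D * 2 = exp (ln (2 * R powr D))"
        using elim by simp
      then show ?case
        using elim by (simp only: exp_le_cancel_iff)
    qed
  qed
  have "\<forall>\<^sub>F R in at_top. \<forall>\<phi>. \<bar>\<phi> - \<theta>\<bar> < \<kappa> / 2 \<longrightarrow> norm (B (rcis R \<phi>)) \<le> exp (R powr (\<rho> / 2))"
    using D(2) asymp eventually_ge_at_top[of 1] eventually_ge_at_top[of "2 * q"]
  proof eventually_elim
    case (elim R)
    define c where "c = rcis R \<theta>"
    have "norm c \<le> R" using elim by (simp add: c_def)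
    then obtain t where t: "\<kappa> * R / 2 < t" "t < \<kappa> * R" and der: "\<And>z. norm (z - c) = t \<Longrightarrow> f z \<noteq> 0 \<and>
       norm (deriv f z) \<le> R powr D * norm (f z) \<and>
       norm (deriv (deriv f) z) \<le> R powr D * norm (f z)"
      using elim(1) by blast
    show ?case
    proof (intro allI impI)
      fix \<phi> assume \<phi>: "\<bar>\<phi> - \<theta>\<bar> < \<kappa> / 2"
      show "norm (B (rcis R \<phi>)) \<le> exp (R powr (\<rho> / 2))"
      proof (rule max_modulus_cball[OF B, of c t])
        have "norm (rcis R \<phi> - c) \<le> R * \<bar>\<phi> - \<theta>\<bar>"
          unfolding c_def using elim by (intro dist_rcis_le) auto
        also have "\<dots> \<le> R * (\<kappa> / 2)"
          using \<phi> elim by (intro mult_left_mono) auto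
        finally show "norm (rcis R \<phi> - c) \<le> t"
          using t by (simp add: mult.commute)
      next
        fix z :: complex assume z: "norm (z - c) = t"
        then have "norm (z - rcis R \<theta>) \<le> \<kappa> * R"
          using t by (simp add: c_def)
        then obtain \<psi> where \<psi>: "z = rcis (norm z) \<psi>" "\<bar>\<psi> - \<theta>\<bar> \<le> 2 * \<kappa>" "R / 2 < norm z"
          using near_ray_rcis[OF _ \<kappa>(1,4)] elim(3) by (metis less_le_trans zero_less_one)
        have "norm (A (rcis (norm z) \<psi>)) \<le> 1"
          using \<psi> \<kappa> elim by (intro small') auto
        then have "norm (A z) \<le> 1"
          using \<psi>(1) by simp
        then have "norm (B z) \<le> R powr D * (1 + 1)"
          using der[OF z] by (intro ode_coefficient_le[OF ode]) auto
        also have "\<dots> \<le> exp (R powr (\<rho> / 2))"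
          using elim by simp
        finally show "norm (B z) \<le> exp (R powr (\<rho> / 2))" .
      qed
    qed
  qed
  then show ?thesis
    unfolding slow_direction_def using \<kappa> \<rho>
    by (intro exI[of _ "\<kappa> / 2"] exI[of _ "\<rho> / 2"] conjI) auto
qed

text \<open>Write \<open>W \<phi>\<close> for the leading coefficient of \<open>P\<close> times \<open>exp(\<i> n \<phi>)\<close>. Directions with \<open>Re W < 0\<close>
are slow by hypothesis. Where \<open>Re W = 0\<close>, the real part changes sign, so slow directions accumulate
and \<open>slow_direction_if_not_borel\<close> applies. A direction with \<open>Re W > 0\<close> lies between the two zeros
of \<open>Re W\<close> nearest to it, whose distance is \<open>\<pi> / n\<close>.\<close>

lemma all_directions_slow:
  fixes B :: "complex \<Rightarrow> complex" and P :: "complex poly"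
  assumes B: "B holomorphic_on UNIV" and \<rho>: "entire_order B = ereal \<rho>" "0 < \<rho>" "\<rho> \<le> degree P"
    and n: "degree P > 0"
    and slow: "\<And>\<theta>. Re (lead_coeff P * exp (\<i> * of_nat (degree P) * of_real \<theta>)) < 0 \<Longrightarrow> slow_direction B \<rho> \<theta>"
    and not_borel: "\<And>\<theta>. borel_direction B \<theta> \<Longrightarrow> \<not> critical_ray P \<theta>"
  shows "slow_direction B \<rho> \<theta>"
proof -
  define n where "n = real (degree P)"
  define W where "W \<phi> = lead_coeff P * exp (\<i> * of_nat (degree P) * of_real \<phi>)" for \<phi>
  have n0: "n > 0"
    using assms(5) by (simp add: n_def)
  have W0: "W \<phi> \<noteq> 0" for \<phi>
    using assms(5) by (auto simp: W_def)
  have W_add: "W (\<phi> + x) = W \<phi> * cis (n * x)" for \<phi> x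
    by (simp add: W_def n_def cis_conv_exp algebra_simps flip: exp_add)
  have critical: "slow_direction B \<rho> \<phi>" if Re0: "Re (W \<phi>) = 0" for \<phi>
  proof (rule slow_direction_if_not_borel[OF B \<rho>(1,2)])
    show "\<not> borel_direction B \<phi>"
      using not_borel[of \<phi>] Re0 unfolding critical_ray_def W_def by blast
    fix \<eta> :: real assume \<eta>: "\<eta> > 0"
    define x where "x = min (\<eta> / 2) (pi / (2 * n))"
    have x: "0 < x" "x < \<eta>" "x \<le> pi / (2 * n)"
      using \<eta> n0 by (auto simp: x_def)
    have "n * x \<le> pi / 2"
      using mult_left_mono[OF x(3), of n] n0 by simp
    moreover have "0 < n * x"
      using n0 x by simp
    ultimately have sin: "sin (n * x) > 0"
      using pi_gt_zero by (intro sin_gt_zero) linarith+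
    \<comment> \<open>The sign picks the side of the critical ray on which the real part is negative.\<close>
    define y where "y = sgn (Im (W \<phi>)) * x"
    have Im0: "Im (W \<phi>) \<noteq> 0"
      using W0[of \<phi>] Re0 by (auto simp: complex_eq_iff)
    have "Re (W (\<phi> + y)) = - (Im (W \<phi>) * sin (n * y))"
      by (simp add: W_add Re0)
    also have "\<dots> = - (\<bar>Im (W \<phi>)\<bar> * sin (n * x))"
      using Im0 by (auto simp: y_def sgn_if)
    also have "\<dots> < 0"
      using Im0 sin by simp
    finally have "slow_direction B \<rho> (\<phi> + y)"
      unfolding W_def by (rule slow)
    moreover have "\<bar>\<phi> + y - \<phi>\<bar> < \<eta>"
      using x Im0 by (auto simp: y_def sgn_if)
    ultimately show "\<exists>\<theta>'. \<bar>\<theta>' - \<phi>\<bar> < \<eta> \<and> slow_direction B \<rho> \<theta>'"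
      by blast
  qed
  consider "Re (W \<theta>) < 0" | "Re (W \<theta>) = 0" | "Re (W \<theta>) > 0"
    by linarith
  then show ?thesis
  proof cases
    case 1
    then show ?thesis
      unfolding W_def by (rule slow)
  next
    case 2
    then show ?thesis
      by (rule critical)
  next
    case 3
    define \<alpha> where "\<alpha> = Arg (W \<theta>)"
    have \<alpha>: "- (pi / 2) < \<alpha>" "\<alpha> < pi / 2"
      using 3 Arg_Re_pos[of "W \<theta>"] by (auto simp: \<alpha>_def)
    have polar: "W \<theta> = norm (W \<theta>) * cis \<alpha>"
      using rcis_cmod_Arg[of "W \<theta>"] by (simp add: \<alpha>_def rcis_def)
    have edge: "Re (W (\<theta> + (b - \<alpha>) / n)) = norm (W \<theta>) * cos b" for b
    proof -
      have "W (\<theta> + (b - \<alpha>) / n) = norm (W \<theta>) * (cis \<alpha> * cis (b - \<alpha>))"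
        unfolding W_add using n0 by (subst polar) (simp add: mult.assoc)
      then show ?thesis
        by (simp add: cis_mult)
    qed
    show ?thesis
    proof (rule slow_direction_between[OF B \<rho>(1,2)])
      show "slow_direction B \<rho> (\<theta> + (- (pi / 2) - \<alpha>) / n)" "slow_direction B \<rho> (\<theta> + (pi / 2 - \<alpha>) / n)"
        by (rule critical, simp only: edge, simp)+
      show "\<theta> + (- (pi / 2) - \<alpha>) / n < \<theta>" "\<theta> < \<theta> + (pi / 2 - \<alpha>) / n"
        using \<alpha> n0 by (auto simp: divide_simps)
      have "\<theta> + x / n - (\<theta> + y / n) = (x - y) / n" for x y
        by (simp add: diff_divide_distrib)
      then have "\<theta> + (pi / 2 - \<alpha>) / n - (\<theta> + (- (pi / 2) - \<alpha>) / n) = pi / n"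
        by simp
      moreover have "\<rho> * (pi / n) \<le> n * (pi / n)"
        using \<rho>(3) n0 by (intro mult_right_mono) (auto simp: n_def)
      ultimately show "\<rho> * (\<theta> + (pi / 2 - \<alpha>) / n - (\<theta> + (- (pi / 2) - \<alpha>) / n)) \<le> pi"
        using n0 by simp
    qed
  qed
qed

theorem theorem10:
  fixes A B v :: "complex \<Rightarrow> complex" and P :: "complex poly"
  assumes "A holomorphic_on UNIV"
    and "v holomorphic_on UNIV"
    and "degree P > 0"
    and "\<And>z. A z = v z * exp (poly P z)"
    and "zeros_exponent A < entire_order A"
    and "entire_order v = zeros_exponent A"
    and "yang_extremal B"
    and "\<And>\<theta>. borel_direction B \<theta> \<Longrightarrow> \<not> critical_ray P \<theta>"
  shows "\<forall>f. f holomorphic_on UNIV \<and> (\<exists>z. f z \<noteq> 0) \<and>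
           (\<forall>z. deriv (deriv f) z + A z * deriv f z + B z * f z = 0)
         \<longrightarrow> entire_order f = \<infinity>"
proof (intro allI impI, elim conjE, rule ccontr)
  fix f :: "complex \<Rightarrow> complex"
  assume f: "f holomorphic_on UNIV" and nz: "\<exists>z. f z \<noteq> 0"
    and ode': "\<forall>z. deriv (deriv f) z + A z * deriv f z + B z * f z = 0"
    and not_inf: "entire_order f \<noteq> \<infinity>"
  have ode: "deriv (deriv f) z + A z * deriv f z + B z * f z = 0" for z
    using ode' by blast
  have finite: "entire_order f < \<infinity>"
    using not_inf by (simp add: less_top[symmetric] top_ereal_def)
  have B: "B holomorphic_on UNIV" and ord_B: "0 < entire_order B" "entire_order B < \<infinity>"
    using assms(7) by (auto simp: yang_extremal_def)
  obtain \<rho> where \<rho>: "entire_order B = ereal \<rho>" "0 < \<rho>"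
    using ord_B by (cases "entire_order B") auto
  define n where "n = real (degree P)"
  have n: "n > 0"
    using assms(3) by (simp add: n_def)
  have "entire_order v < ereal n"
    unfolding n_def using assms(5,6) by (intro entire_order_exp_factor_less[OF assms(2,4) _ assms(3)]) simp
  then obtain x where x: "entire_order v < ereal x" "x < n"
    using ereal_dense2 by force
  \<comment> \<open>A nonnegative exponent is wanted below, and \<open>x\<close> may be negative.\<close>
  define \<sigma> where "\<sigma> = max x (n / 2)"
  have \<sigma>: "0 \<le> \<sigma>" "\<sigma> < n" "entire_order v < ereal \<sigma>"
    using x n by (auto simp: \<sigma>_def intro: less_le_trans)
  obtain q where v_growth: "\<And>z. norm z \<ge> q \<Longrightarrow> norm (v z) \<le> exp (norm z powr \<sigma>)"
    using order_less_imp_growth[OF assms(2) \<sigma>(3)] by blast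
  obtain C q' where C: "C \<ge> 0" and A_growth:
    "\<And>z. norm z \<ge> q' \<Longrightarrow> norm (A z) \<le> exp (norm z powr \<sigma> + C * norm z powr n)"
    using exp_poly_times_growth[OF v_growth, where P = P] unfolding assms(4)[symmetric] n_def by metis
  have "entire_order B \<le> ereal n"
    by (rule order_of_zero_order_coefficient_le[OF B f nz finite ode A_growth C \<sigma>(1)]) (use \<sigma>(2) in auto)
  then have \<rho>n: "\<rho> \<le> degree P"
    using \<rho> by (simp add: n_def)
  have "slow_direction B \<rho> \<theta>" for \<theta>
  proof (rule all_directions_slow[OF B \<rho> \<rho>n assms(3) _ assms(8)])
    fix \<theta> assume neg: "Re (lead_coeff P * exp (\<i> * of_nat (degree P) * of_real \<theta>)) < 0"
    have "\<sigma> < degree P"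
      using \<sigma>(2) by (simp add: n_def)
    then have "\<exists>\<delta>>0. \<forall>\<^sub>F r in at_top. \<forall>\<phi>. \<bar>\<phi> - \<theta>\<bar> \<le> \<delta> \<longrightarrow> norm (A (rcis r \<phi>)) \<le> 1"
      unfolding assms(4)
      by (intro exp_poly_times_small[where q = q and \<sigma> = \<sigma>] v_growth assms(3) neg)
    then show "slow_direction B \<rho> \<theta>"
      using slow_direction_of_small_coefficient[OF B f nz finite ode _ _ \<rho>(2)] by blast
  qed
  then have "entire_order B < ereal \<rho>"
    by (rule order_less_if_all_directions_slow)
  then show False
    using \<rho> by simp
qed

end
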